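(* Let $W$ be a quasi-balanced weighing matrix such that $|W|$ is the incidence matrix of a symmetric group divisible design with parameters $(v,k,m,n,\lambda_1,\lambda_2)$ (so $v=mn$, $m,n\ge2$, $k>0$) and such that $|W|\,\mathcal J_{m,n}=\mathcal J_{m,n}\,|W|=\frac{k}{m-1}(J_v-\mathcal J_{m,n})$. Write $W=W_1-W_2$ with $W_1,W_2$ disjoint $(0,1)$-matrices, and let $\Pi=\begin{pmatrix}0&1\\1&0\end{pmatrix}$. Define the $4v\times 4v$ matrices $$A_0=\begin{pmatrix} I_2\otimes I_v&0\\0&I_2\otimes I_v\end{pmatrix},\quad A_1=\begin{pmatrix} \Pi\otimes I_v&0\\0&\Pi\otimes I_v\end{pmatrix},$$ $$A_2=\begin{pmatrix} J_2\otimes(\mathcal J_{m,n}-I_v)&0\\0&J_2\otimes(\mathcal J_{m,n}-I_v)\end{pmatrix},\quad A_3=\begin{pmatrix} J_2\otimes (J_v-\mathcal J_{m,n})&0\\0&J_2\otimes (J_v-\mathcal J_{m,n})\end{pmatrix},$$ $$A_4=\begin{pmatrix}0&I_2\otimes W_1+\Pi\otimes W_2\\ I_2\otimes W_1^\top+\Pi\otimes W_2^\top&0\end{pmatrix},\quad A_5=\begin{pmatrix}0&I_2\otimes W_2+\Pi\otimes W_1\\ I_2\otimes W_2^\top+\Pi\otimes W_1^\top&0\end{pmatrix},$$ $$A_6=\begin{pmatrix}0&J_2\otimes(J_v-W_1-W_2-\mathcal J_{m,n})\\ J_2\otimes(J_v-W_1^\top-W_2^\top-\mathcal J_{m,n})&0\end{pmatrix},\quad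 A_7=\begin{pmatrix}0&J_2\otimes\mathcal J_{m,n}\\ J_2\otimes\mathcal J_{m,n}&0\end{pmatrix}.$$ If $k<v$, then $\{A_i\}_{i=0}^7$ is an association scheme with the (first and second) eigenmatrices $P$ and $Q$ given by $$P=\begin{pmatrix} 1 & 1 & 2 (n-1) & 2 (m-1) n & k & k & 2 (-k+m n-n) & 2 n \\ 1 & -1 & 0 & 0 & \sqrt{k} & -\sqrt{k} & 0 & 0 \\ 1 & 1 & 2 (n-1) & -2 n & \frac{k}{1-m} & \frac{k}{1-m} & \frac{2 (k-m n+n)}{m-1} & 2 n \\ 1 & 1 & 2 (n-1) & -2 n & \frac{k}{m-1} & \frac{k}{m-1} & -\frac{2 (k-m n+n)}{m-1} & -2 n \\ 1 & -1 & 0 & 0 & -\sqrt{k} & \sqrt{k} & 0 & 0 \\ 1 & 1 & 2 (n-1) & 2 (m-1) n & -k & -k & 2 (k-m n+n) & -2 n \\ 1 & 1 & -2 & 0 & -\frac{\sqrt{k(m n-n-k)}}{ \sqrt{(m-1)(n-1)}} & -\frac{\sqrt{k(m n-n-k)}}{ \sqrt{(m-1)(n-1)}} & \frac{2\sqrt{k(m n-n-k)}}{ \sqrt{(m-1)(n-1)}} & 0 \\ 1 & 1 & -2 & 0 & \frac{\sqrt{k(m n-n-k)}}{ \sqrt{(m-1)(n-1)}} & \frac{\sqrt{k(m n-n-k)}}{ \sqrt{(m-1)(n-1)}} & -\frac{2\sqrt{k(m n-n-k)}}{ \sqrt{(m-1)(n-1)}} & 0 \end{pmatrix},$$ $$Q=\begin{pmatrix}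 1 & m n & m-1 & m-1 & m n & 1 & m (n-1) & m (n-1) \\ 1 & -m n & m-1 & m-1 & -m n & 1 & m (n-1) & m (n-1) \\ 1 & 0 & m-1 & m-1 & 0 & 1 & -m & -m \\ 1 & 0 & -1 & -1 & 0 & 1 & 0 & 0 \\ 1 & \frac{m n}{\sqrt{k}} & -1 & 1 & -\frac{m n}{\sqrt{k}} & -1 & -\frac{m \sqrt{(n-1)(mn-n-k)}}{\sqrt{k(m-1)}} & \frac{m \sqrt{(n-1)(mn-n-k)}}{\sqrt{k(m-1)}} \\ 1 & -\frac{m n}{\sqrt{k}} & -1 & 1 & \frac{m n}{\sqrt{k}} & -1 & -\frac{m \sqrt{(n-1)(mn-n-k)}}{\sqrt{k(m-1)}} & \frac{m \sqrt{(n-1)(mn-n-k)}}{\sqrt{k(m-1)}} \\ 1 & 0 & -1 & 1 & 0 & -1 & \frac{m \sqrt{k(n-1)}}{ \sqrt{(m-1)(mn-n-k)}} & -\frac{m \sqrt{k(n-1)}}{ \sqrt{(m-1)(mn-n-k)}} \\ 1 & 0 & m-1 & -m+1 & 0 & -1 & 0 & 0 \end{pmatrix}.$$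
   Context: $I_r$, $J_r$ are the identity and all-ones matrices of order $r$, and $\mathcal J_{m,n}=I_m\otimes J_n$. A weighing matrix of order $v$ and weight $k$ is a $v\times v$ matrix $W$ with entries in $\{0,1,-1\}$ satisfying $WW^\top=kI_v$. $|W|$ is its entrywise absolute value. $W$ is quasi-balanced if $|W|\,|W|^\top=|W|^\top|W|$ and the off-diagonal entries of $|W|\,|W|^\top$ take at most two distinct values. Two $(0,1)$-matrices are disjoint if no position is nonzero in both. For $m,n\ge2$ and $v=mn$, a $v\times v$ $(0,1)$-matrix $A$ is (the incidence matrix of) a symmetric group divisible design with parameters $(v,k,m,n,\lambda_1,\lambda_2)$ if $$AA^\top=A^\top A=kI_v+\lambda_1(\mathcal J_{m,n}-I_v)+\lambda_2(J_v-\mathcal J_{m,n}).$$ Association schemes here are symmetric: a symmetric association scheme with $d$ classes on a finite set $X$ is a set of nonzero $(0,1)$-matrices $A_0,\dots,A_d$ with rows and columns indexed by $X$ such that $A_0=I$, $\sum_i A_i=J$, $A_i^\top=A_i$, and $A_iA_j=\sum_{h} p_{ij}^hA_h$ for non-negative integers $p_{ij}^h$. Its Bose–Mesner algebra (the complex span of the $A_i$) has a basis of primitive idempotents $E_0=\frac1{|X|}J,E_1,\dots,E_d$, and, for an ordering of these idempotents, the first and second eigenmatrices $P,Q$ (rows and columns indexed from $0$ to $d$) are defined by $A_j=\sum_i P_{ij}E_i$ and $E_j=\frac1{|X|}\sum_i Q_{ij}A_i$.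
   Formalization: The case k=(m-1)n is excluded: there |W|=J_v-J_{m,n}, so A_6=0 is not a nonzero matrix and Q has zero denominators (e.g. m=n=2, k=2, W with off-diagonal blocks a Hadamard matrix of order 2 and its transpose), so the claim fails. *)

theory Defs
  imports "HOL-Analysis.Analysis"
begin

text \<open>
  Matrices are taken over the complex numbers, with rows and columns indexed by finite types.
  The index set of the \<open>v \<times> v\<close> matrices, \<open>v = mn\<close>, is \<open>'m \<times> 'n\<close> with
  \<open>CARD('m) = m\<close> and \<open>CARD('n) = n\<close>; the block ordering of the rows underlying
  \<open>I\<^sub>m \<otimes> J\<^sub>n\<close> is the grouping of the pairs by their first component.
\<close>

definition smult_mat :: "complex \<Rightarrow> complex^'c::finite^'r::finite \<Rightarrow> complex^'c^'r"
    (infixr "\<cdot>\<^sub>m" 75) where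
  "c \<cdot>\<^sub>m A = map_matrix (\<lambda>z. c * z) A"

definition all_ones :: "complex^'c::finite^'r::finite" ("\<J>") where
  "\<J> = (\<chi> i j. 1)"

definition kron ::
    "complex^'c1::finite^'r1::finite \<Rightarrow> complex^'c2::finite^'r2::finite
      \<Rightarrow> complex^('c1 \<times> 'c2)^('r1 \<times> 'r2)" (infixr "\<otimes>\<^sub>k" 80) where
  "A \<otimes>\<^sub>k B = (\<chi> i j. A $ fst i $ fst j * B $ snd i $ snd j)"

definition block_ones :: "complex^('m::finite \<times> 'n::finite)^('m \<times> 'n)" ("\<J>\<^sub>b") where
  "\<J>\<^sub>b = mat 1 \<otimes>\<^sub>k \<J>"

definition block_mat ::
    "complex^'c1::finite^'r1::finite \<Rightarrow> complex^'c2::finite^'r1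
      \<Rightarrow> complex^'c1^'r2::finite \<Rightarrow> complex^'c2^'r2
      \<Rightarrow> complex^('c1 + 'c2)^('r1 + 'r2)" where
  "block_mat A B C D = (\<chi> p q. case p of
       Inl i \<Rightarrow> (case q of Inl j \<Rightarrow> A $ i $ j | Inr j \<Rightarrow> B $ i $ j)
     | Inr i \<Rightarrow> (case q of Inl j \<Rightarrow> C $ i $ j | Inr j \<Rightarrow> D $ i $ j))"

definition abs_mat :: "complex^'c::finite^'r::finite \<Rightarrow> complex^'c^'r" where
  "abs_mat A = map_matrix (\<lambda>z. complex_of_real (cmod z)) A"

definition zero_one_mat :: "complex^'c::finite^'r::finite \<Rightarrow> bool" where
  "zero_one_mat A \<longleftrightarrow> (\<forall>i j. A $ i $ j \<in> {0, 1})"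

definition disjoint_mats ::
    "complex^'c::finite^'r::finite \<Rightarrow> complex^'c^'r \<Rightarrow> bool" where
  "disjoint_mats A B \<longleftrightarrow> (\<forall>i j. \<not> (A $ i $ j \<noteq> 0 \<and> B $ i $ j \<noteq> 0))"

definition weighing_matrix :: "nat \<Rightarrow> complex^'x::finite^'x \<Rightarrow> bool" where
  "weighing_matrix w W \<longleftrightarrow>
     (\<forall>i j. W $ i $ j \<in> {0, 1, -1}) \<and> W ** transpose W = of_nat w \<cdot>\<^sub>m mat 1"

definition quasi_balanced :: "complex^'x::finite^'x \<Rightarrow> bool" where
  "quasi_balanced W \<longleftrightarrow>
     abs_mat W ** transpose (abs_mat W) = transpose (abs_mat W) ** abs_mat W \<and>
     card {(abs_mat W ** transpose (abs_mat W)) $ i $ j | i j. i \<noteq> j} \<le> 2"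

definition symmetric_gdd ::
    "nat \<Rightarrow> nat \<Rightarrow> nat \<Rightarrow> nat \<Rightarrow> nat \<Rightarrow> nat
      \<Rightarrow> complex^('m::finite \<times> 'n::finite)^('m \<times> 'n) \<Rightarrow> bool" where
  "symmetric_gdd v k m n l1 l2 A \<longleftrightarrow>
     m = CARD('m) \<and> n = CARD('n) \<and> m \<ge> 2 \<and> n \<ge> 2 \<and> v = m * n \<and>
     zero_one_mat A \<and>
     A ** transpose A = transpose A ** A \<and>
     A ** transpose A =
       of_nat k \<cdot>\<^sub>m mat 1 + of_nat l1 \<cdot>\<^sub>m (\<J>\<^sub>b - mat 1) + of_nat l2 \<cdot>\<^sub>m (\<J> - \<J>\<^sub>b)"

definition symmetric_association_scheme ::
    "nat \<Rightarrow> (nat \<Rightarrow> complex^'x::finite^'x) \<Rightarrow> bool" where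
  "symmetric_association_scheme d A \<longleftrightarrow>
     (\<forall>i\<le>d. zero_one_mat (A i) \<and> A i \<noteq> 0) \<and>
     A 0 = mat 1 \<and>
     (\<Sum>i\<le>d. A i) = \<J> \<and>
     (\<forall>i\<le>d. transpose (A i) = A i) \<and>
     (\<exists>p :: nat \<Rightarrow> nat \<Rightarrow> nat \<Rightarrow> nat.
        \<forall>i\<le>d. \<forall>j\<le>d. A i ** A j = (\<Sum>h\<le>d. of_nat (p i j h) \<cdot>\<^sub>m A h))"

definition bose_mesner ::
    "nat \<Rightarrow> (nat \<Rightarrow> complex^'x::finite^'x) \<Rightarrow> (complex^'x^'x) set" where
  "bose_mesner d A = {\<Sum>i\<le>d. c i \<cdot>\<^sub>m A i | c. True}"

definition primitive_idempotent ::
    "(complex^'x::finite^'x) set \<Rightarrow> complex^'x^'x \<Rightarrow> bool" where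
  "primitive_idempotent B E \<longleftrightarrow>
     E \<in> B \<and> E \<noteq> 0 \<and> E ** E = E \<and>
     \<not> (\<exists>F\<in>B. \<exists>G\<in>B. F \<noteq> 0 \<and> G \<noteq> 0 \<and> F ** F = F \<and> G ** G = G \<and>
          F ** G = 0 \<and> G ** F = 0 \<and> E = F + G)"

definition idempotent_ordering ::
    "nat \<Rightarrow> (nat \<Rightarrow> complex^'x::finite^'x) \<Rightarrow> (nat \<Rightarrow> complex^'x^'x) \<Rightarrow> bool" where
  "idempotent_ordering d A E \<longleftrightarrow>
     bij_betw E {..d} {F. primitive_idempotent (bose_mesner d A) F} \<and>
     E 0 = (1 / of_nat CARD('x)) \<cdot>\<^sub>m \<J>"

definition is_first_eigenmatrix ::
    "nat \<Rightarrow> (nat \<Rightarrow> complex^'x::finite^'x) \<Rightarrow> (nat \<Rightarrow> complex^'x^'x)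
      \<Rightarrow> (nat \<Rightarrow> nat \<Rightarrow> complex) \<Rightarrow> bool" where
  "is_first_eigenmatrix d A E P \<longleftrightarrow> (\<forall>j\<le>d. A j = (\<Sum>i\<le>d. P i j \<cdot>\<^sub>m E i))"

definition is_second_eigenmatrix ::
    "nat \<Rightarrow> (nat \<Rightarrow> complex^'x::finite^'x) \<Rightarrow> (nat \<Rightarrow> complex^'x^'x)
      \<Rightarrow> (nat \<Rightarrow> nat \<Rightarrow> complex) \<Rightarrow> bool" where
  "is_second_eigenmatrix d A E Q \<longleftrightarrow>
     (\<forall>j\<le>d. E j = (1 / of_nat CARD('x)) \<cdot>\<^sub>m (\<Sum>i\<le>d. Q i j \<cdot>\<^sub>m A i))"

definition swap_mat :: "complex^2^2" ("\<Pi>\<^sub>2") where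
  "\<Pi>\<^sub>2 = vector [vector [0, 1], vector [1, 0]]"

definition scheme_mats ::
    "complex^('m::finite \<times> 'n::finite)^('m \<times> 'n) \<Rightarrow> complex^('m \<times> 'n)^('m \<times> 'n)
      \<Rightarrow> nat \<Rightarrow> complex^(2 \<times> ('m \<times> 'n) + 2 \<times> ('m \<times> 'n))^(2 \<times> ('m \<times> 'n) + 2 \<times> ('m \<times> 'n))"
  where
  "scheme_mats W1 W2 i =
    (let I2 = mat 1 :: complex^2^2; J2 = \<J> :: complex^2^2;
         I = mat 1 :: complex^('m \<times> 'n)^('m \<times> 'n);
         J = \<J> :: complex^('m \<times> 'n)^('m \<times> 'n)
     in
     [block_mat (I2 \<otimes>\<^sub>k I) 0
                0 (I2 \<otimes>\<^sub>k I),
      block_mat (\<Pi>\<^sub>2 \<otimes>\<^sub>k I) 0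
                0 (\<Pi>\<^sub>2 \<otimes>\<^sub>k I),
      block_mat (J2 \<otimes>\<^sub>k (\<J>\<^sub>b - I)) 0
                0 (J2 \<otimes>\<^sub>k (\<J>\<^sub>b - I)),
      block_mat (J2 \<otimes>\<^sub>k (J - \<J>\<^sub>b)) 0
                0 (J2 \<otimes>\<^sub>k (J - \<J>\<^sub>b)),
      block_mat 0 (I2 \<otimes>\<^sub>k W1 + \<Pi>\<^sub>2 \<otimes>\<^sub>k W2)
                (I2 \<otimes>\<^sub>k transpose W1 + \<Pi>\<^sub>2 \<otimes>\<^sub>k transpose W2) 0,
      block_mat 0 (I2 \<otimes>\<^sub>k W2 + \<Pi>\<^sub>2 \<otimes>\<^sub>k W1)
                (I2 \<otimes>\<^sub>k transpose W2 + \<Pi>\<^sub>2 \<otimes>\<^sub>k transpose W1) 0,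
      block_mat 0 (J2 \<otimes>\<^sub>k (J - W1 - W2 - \<J>\<^sub>b))
                (J2 \<otimes>\<^sub>k (J - transpose W1 - transpose W2 - \<J>\<^sub>b)) 0,
      block_mat 0 (J2 \<otimes>\<^sub>k \<J>\<^sub>b)
                (J2 \<otimes>\<^sub>k \<J>\<^sub>b) 0] ! i)"

text \<open>The explicit eigenmatrices, meaningful for row and column indices in \<open>{0..7}\<close>.\<close>

definition eigP :: "real \<Rightarrow> real \<Rightarrow> real \<Rightarrow> nat \<Rightarrow> nat \<Rightarrow> real" where
  "eigP m n k i j =
    (let s = sqrt (k * (m*n - n - k)) / sqrt ((m - 1) * (n - 1)) in
     [[1, 1, 2*(n - 1), 2*(m - 1)*n, k, k, 2*(- k + m*n - n), 2*n],
      [1, -1, 0, 0, sqrt k, - sqrt k, 0, 0],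
      [1, 1, 2*(n - 1), - 2*n, k / (1 - m), k / (1 - m), 2*(k - m*n + n) / (m - 1), 2*n],
      [1, 1, 2*(n - 1), - 2*n, k / (m - 1), k / (m - 1), - (2*(k - m*n + n) / (m - 1)), - 2*n],
      [1, -1, 0, 0, - sqrt k, sqrt k, 0, 0],
      [1, 1, 2*(n - 1), 2*(m - 1)*n, - k, - k, 2*(k - m*n + n), - 2*n],
      [1, 1, -2, 0, - s, - s, 2 * s, 0],
      [1, 1, -2, 0, s, s, - 2 * s, 0]] ! i ! j)"

definition eigQ :: "real \<Rightarrow> real \<Rightarrow> real \<Rightarrow> nat \<Rightarrow> nat \<Rightarrow> real" where
  "eigQ m n k i j =
    (let s = m * sqrt ((n - 1) * (m*n - n - k)) / sqrt (k * (m - 1));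
         t = m * sqrt (k * (n - 1)) / sqrt ((m - 1) * (m*n - n - k)) in
     [[1, m*n, m - 1, m - 1, m*n, 1, m*(n - 1), m*(n - 1)],
      [1, - (m*n), m - 1, m - 1, - (m*n), 1, m*(n - 1), m*(n - 1)],
      [1, 0, m - 1, m - 1, 0, 1, - m, - m],
      [1, 0, -1, -1, 0, 1, 0, 0],
      [1, m*n / sqrt k, -1, 1, - (m*n / sqrt k), -1, - s, s],
      [1, - (m*n / sqrt k), -1, 1, m*n / sqrt k, -1, - s, s],
      [1, 0, -1, 1, 0, -1, t, - t],
      [1, 0, m - 1, - m + 1, 0, -1, 0, 0]] ! i ! j)"

end

theory Submission
  imports Defs
begin

text \<open>
  Up to the swap \<open>\<Pi>\<close>, which has eigenspace projections \<open>\<J>/2\<close> and \<open>\<Delta>/2\<close> with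
  \<open>\<Delta> = I - \<Pi>\<close>, the algebra splits into two pieces: on the first one \<open>|W|\<close> acts, on the second one
  \<open>W\<close>. Every candidate idempotent is \<open>1/4\<close> of a block matrix with diagonal blocks \<open>S \<otimes> X\<close> and
  off-diagonal blocks \<open>\<plusminus>S \<otimes> Y\<close>, \<open>\<plusminus>S \<otimes> Y\<^sup>T\<close>, where \<open>X\<close> is a projection and
  \<open>Y Y\<^sup>T = Y\<^sup>T Y = X\<close>. The four triples \<open>(S, X, Y)\<close> are \<open>(\<J>, J/v, J/v)\<close>,
  \<open>(\<J>, \<J>\<^sub>b/n - J/v, \<J>\<^sub>b/n - J/v)\<close>, \<open>(\<J>, I - \<J>\<^sub>b/n, D/s)\<close> and \<open>(\<Delta>, I, W/\<surd>k)\<close>, with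
  \<open>D = |W| - k/((m-1)n) (J - \<J>\<^sub>b)\<close>. Since \<open>D \<J>\<^sub>b = 0\<close>, the matrix \<open>D D\<^sup>T\<close> is a multiple
  \<open>s\<^sup>2\<close> of \<open>I - \<J>\<^sub>b/n\<close>, and \<open>s\<close> is read off the diagonal.
  The eight idempotents and the \<open>A\<^sub>i\<close> span the same space because \<open>Q P = 4v I\<close>; the intersection
  numbers are then automatically non-negative integers, being entries of products of
  \<open>(0,1)\<close>-matrices.
\<close>

section \<open>Entrywise rules and algebra of scalar multiples, Kronecker products and block
  matrices\<close>

lemma smult_mat_nth [simp]: "(c \<cdot>\<^sub>m A) $ i $ j = c * A $ i $ j"
  by (simp add: smult_mat_def map_matrix_def)

lemma all_ones_nth [simp]: "\<J> $ i $ j = 1"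
  by (simp add: all_ones_def)

lemma kron_nth [simp]: "(A \<otimes>\<^sub>k B) $ i $ j = A $ fst i $ fst j * B $ snd i $ snd j"
  by (simp add: kron_def)

lemma block_ones_nth [simp]: "\<J>\<^sub>b $ p $ q = (if fst p = fst q then 1 else 0)"
  by (simp add: block_ones_def mat_def)

lemma abs_mat_nth [simp]: "abs_mat A $ i $ j = complex_of_real (cmod (A $ i $ j))"
  by (simp add: abs_mat_def map_matrix_def)

lemma block_mat_nth [simp]:
  "block_mat A B C D $ Inl i $ Inl j = A $ i $ j"
  "block_mat A B C D $ Inl i $ Inr j' = B $ i $ j'"
  "block_mat A B C D $ Inr i' $ Inl j = C $ i' $ j"
  "block_mat A B C D $ Inr i' $ Inr j' = D $ i' $ j'"
  by (simp_all add: block_mat_def)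

lemma swap_mat_nth [simp]: "\<Pi>\<^sub>2 $ i $ j = (if i = j then 0 else 1)"
  using exhaust_2[of i] exhaust_2[of j] by (auto simp: swap_mat_def)

lemma matrix_eqI: "(\<And>i j. A $ i $ j = B $ i $ j) \<Longrightarrow> A = B"
  by (simp add: vec_eq_iff)

lemma matrix_mult_nth: "(A ** B) $ i $ j = (\<Sum>k\<in>UNIV. A $ i $ k * B $ k $ j)"
  by (simp add: matrix_matrix_mult_def)

lemma transpose_nth [simp]: "transpose A $ i $ j = A $ j $ i"
  by (simp add: transpose_def)

lemma ex_distinct: "CARD('a::finite) \<ge> 2 \<Longrightarrow> \<exists>x y :: 'a::finite. x \<noteq> y"
  by (metis One_nat_def Suc_1 UNIV_I card_le_Suc0_iff_eq finite not_less_eq_eq)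

lemma smult_matrix_mult: "(c \<cdot>\<^sub>m A) ** B = c \<cdot>\<^sub>m (A ** B)"
  by (rule matrix_eqI) (simp add: matrix_mult_nth sum_distrib_left mult.assoc)

lemma matrix_mult_smult: "A ** (c \<cdot>\<^sub>m B) = c \<cdot>\<^sub>m (A ** B)"
  by (rule matrix_eqI) (simp add: matrix_mult_nth sum_distrib_left mult_ac)

lemma smult_smult_mat: "c \<cdot>\<^sub>m d \<cdot>\<^sub>m A = (c * d) \<cdot>\<^sub>m A"
  by (rule matrix_eqI) simp

lemma one_smult_mat: "1 \<cdot>\<^sub>m A = A"
  by (rule matrix_eqI) simp

lemma zero_smult_mat: "0 \<cdot>\<^sub>m A = 0"
  by (rule matrix_eqI) simp

lemma smult_zero_mat: "c \<cdot>\<^sub>m 0 = 0"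
  by (rule matrix_eqI) simp

lemma smult_sum_mat: "c \<cdot>\<^sub>m (\<Sum>i\<in>I. f i) = (\<Sum>i\<in>I. c \<cdot>\<^sub>m f i)"
  by (rule matrix_eqI) (simp add: sum_distrib_left)

lemma sum_smult_mat: "(\<Sum>i\<in>I. c i \<cdot>\<^sub>m A) = (\<Sum>i\<in>I. c i) \<cdot>\<^sub>m A"
  by (rule matrix_eqI) (simp add: sum_distrib_right)

lemma matrix_add_rdistrib_complex:
  fixes B C :: "complex^'b::finite^'a::finite" and A :: "complex^'c::finite^'b"
  shows "(B + C) ** A = B ** A + C ** A"
  by (rule matrix_eqI) (simp add: matrix_mult_nth algebra_simps sum.distrib)

lemma sum_matrix_mult:
  fixes f :: "'i \<Rightarrow> complex^'b::finite^'a::finite" and B :: "complex^'c::finite^'b"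
  shows "(\<Sum>i\<in>I. f i) ** B = (\<Sum>i\<in>I. f i ** B)"
  by (induction I rule: infinite_finite_induct) (simp_all add: matrix_add_rdistrib_complex)

lemma matrix_mult_sum:
  fixes f :: "'i \<Rightarrow> complex^'c::finite^'b::finite" and B :: "complex^'b^'a::finite"
  shows "B ** (\<Sum>i\<in>I. f i) = (\<Sum>i\<in>I. B ** f i)"
  by (induction I rule: infinite_finite_induct) (simp_all add: matrix_add_ldistrib)

lemma matrix_diff_ldistrib:
  fixes A :: "complex^'b::finite^'a::finite" and B C :: "complex^'c::finite^'b"
  shows "A ** (B - C) = A ** B - A ** C"
  by (rule matrix_eqI) (simp add: matrix_mult_nth algebra_simps sum_subtractf)

lemma matrix_diff_rdistrib:
  fixes B C :: "complex^'b::finite^'a::finite" and A :: "complex^'c::finite^'b"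
  shows "(B - C) ** A = B ** A - C ** A"
  by (rule matrix_eqI) (simp add: matrix_mult_nth algebra_simps sum_subtractf)

lemma transpose_smult_mat: "transpose (c \<cdot>\<^sub>m A) = c \<cdot>\<^sub>m transpose A"
  by (rule matrix_eqI) simp

lemma transpose_diff_mat:
  fixes A B :: "complex^'b::finite^'a::finite"
  shows "transpose (A - B) = transpose A - transpose B"
  by (rule matrix_eqI) simp

lemma kron_matrix_mult: "(A \<otimes>\<^sub>k B) ** (C \<otimes>\<^sub>k D) = (A ** C) \<otimes>\<^sub>k (B ** D)"
  by (rule matrix_eqI)
    (simp add: matrix_mult_nth sum_product sum.cartesian_product mult_ac case_prod_unfold
      flip: UNIV_Times_UNIV)

lemma block_mat_mult:
  "block_mat A B C D ** block_mat A' B' C' D' =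
    block_mat (A ** A' + B ** C') (A ** B' + B ** D') (C ** A' + D ** C') (C ** B' + D ** D')"
proof (rule matrix_eqI)
  fix i j
  show "(block_mat A B C D ** block_mat A' B' C' D') $ i $ j =
    block_mat (A ** A' + B ** C') (A ** B' + B ** D') (C ** A' + D ** C') (C ** B' + D ** D') $ i $ j"
    by (cases i; cases j) (simp_all add: matrix_mult_nth sum.Plus flip: UNIV_Plus_UNIV)
qed

lemma all_ones_mult:
  "(\<J> :: complex^'b::finite^'a::finite) ** (\<J> :: complex^'c::finite^'b) = of_nat CARD('b) \<cdot>\<^sub>m \<J>"
  by (rule matrix_eqI) (simp add: matrix_mult_nth)

lemma kron_all_ones: "\<J> \<otimes>\<^sub>k \<J> = \<J>"
  by (rule matrix_eqI) simp

lemma kron_smult: "A \<otimes>\<^sub>k (c \<cdot>\<^sub>m B) = c \<cdot>\<^sub>m (A \<otimes>\<^sub>k B)"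
  by (rule matrix_eqI) simp

text \<open>Both matrices are Kronecker products, \<open>mat 1 \<otimes>\<^sub>k \<J>\<close> and
  \<open>\<J> \<otimes>\<^sub>k \<J>\<close>, so the products are computed factor by factor.\<close>

lemma block_ones_mult:
  fixes Jb :: "complex^('m::finite \<times> 'n::finite)^('m \<times> 'n)"
  assumes "Jb = \<J>\<^sub>b"
  shows "Jb ** Jb = of_nat CARD('n) \<cdot>\<^sub>m Jb"
    and "Jb ** \<J> = of_nat CARD('n) \<cdot>\<^sub>m (\<J> :: complex^('m \<times> 'n)^('m \<times> 'n))"
    and "\<J> ** Jb = of_nat CARD('n) \<cdot>\<^sub>m (\<J> :: complex^('m \<times> 'n)^('m \<times> 'n))"
  unfolding assms block_ones_def kron_all_ones[symmetric]
  by (simp_all only: kron_matrix_mult all_ones_mult kron_smult matrix_mul_lid matrix_mul_rid)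

lemma transpose_block_ones: "transpose \<J>\<^sub>b = \<J>\<^sub>b"
  by (rule matrix_eqI) simp

lemma transpose_all_ones: "transpose \<J> = \<J>"
  by (rule matrix_eqI) simp

section \<open>Association schemes from orthogonal idempotents\<close>

lemma sum_orthogonal_mult:
  fixes E :: "nat \<Rightarrow> complex^'x::finite^'x"
  assumes orth: "\<And>i j. i \<le> d \<Longrightarrow> j \<le> d \<Longrightarrow> E i ** E j = (if i = j then E i else 0)"
  shows "(\<Sum>i\<le>d. a i \<cdot>\<^sub>m E i) ** (\<Sum>i\<le>d. b i \<cdot>\<^sub>m E i) = (\<Sum>i\<le>d. (a i * b i) \<cdot>\<^sub>m E i)"
proof -
  have "(\<Sum>i\<le>d. a i \<cdot>\<^sub>m E i) ** (\<Sum>i\<le>d. b i \<cdot>\<^sub>m E i) =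
      (\<Sum>i\<le>d. \<Sum>j\<le>d. (a i * b j) \<cdot>\<^sub>m (E i ** E j))"
    unfolding sum_matrix_mult
    by (simp add: matrix_mult_sum smult_matrix_mult matrix_mult_smult smult_smult_mat
        mult.commute[of "b _"])
  also have "\<dots> = (\<Sum>i\<le>d. \<Sum>j\<le>d. if i = j then (a i * b j) \<cdot>\<^sub>m E i else 0)"
    by (intro sum.cong refl) (simp add: orth smult_zero_mat)
  finally show ?thesis by simp
qed

text \<open>Each \<open>E j\<close> absorbs any idempotent of the span: the product with it is 0 or
  \<open>E j\<close>. A nonzero idempotent therefore contains some \<open>E j\<close>, and
  primitivity rules out a nonzero remainder. Conversely, a summand in a splitting of
  \<open>E j\<close> is fixed by \<open>E j\<close>, hence equals it or vanishes.\<close>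

lemma primitive_idempotent_iff:
  fixes E :: "nat \<Rightarrow> complex^'x::finite^'x"
  assumes span: "B = range (\<lambda>c. \<Sum>i\<le>d. c i \<cdot>\<^sub>m E i)"
    and orth: "\<And>i j. i \<le> d \<Longrightarrow> j \<le> d \<Longrightarrow> E i ** E j = (if i = j then E i else 0)"
    and nonzero: "\<And>i. i \<le> d \<Longrightarrow> E i \<noteq> 0"
  shows "primitive_idempotent B F \<longleftrightarrow> F \<in> E ` {..d}"
proof -
  have in_B: "E j \<in> B" if "j \<le> d" for j
  proof -
    have "E j = (\<Sum>i\<le>d. (if i = j then 1 else 0) \<cdot>\<^sub>m E i)"
      using that by (simp add: if_distrib[of "\<lambda>c. c \<cdot>\<^sub>m _"] one_smult_mat zero_smult_mat cong: if_cong)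
    then show ?thesis
      unfolding span by (intro range_eqI[where x = "\<lambda>i. if i = j then 1 else 0"])
  qed
  have absorb: "\<exists>c. F ** E j = c \<cdot>\<^sub>m E j \<and> E j ** F = c \<cdot>\<^sub>m E j" if "F \<in> B" "j \<le> d" for F j
  proof -
    from \<open>F \<in> B\<close> obtain c where F: "F = (\<Sum>i\<le>d. c i \<cdot>\<^sub>m E i)"
      unfolding span by blast
    have "F ** E j = (\<Sum>i\<le>d. c i \<cdot>\<^sub>m (E i ** E j))"
      by (simp add: F sum_matrix_mult smult_matrix_mult)
    also have "\<dots> = (\<Sum>i\<le>d. if i = j then c i \<cdot>\<^sub>m E i else 0)"
      using that by (intro sum.cong refl) (simp add: orth smult_zero_mat)
    finally have 1: "F ** E j = c j \<cdot>\<^sub>m E j" using that by simp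
    have "E j ** F = (\<Sum>i\<le>d. c i \<cdot>\<^sub>m (E j ** E i))"
      by (simp add: F matrix_mult_sum matrix_mult_smult)
    also have "\<dots> = (\<Sum>i\<le>d. if i = j then c i \<cdot>\<^sub>m E i else 0)"
      using that by (intro sum.cong refl) (simp add: orth smult_zero_mat)
    finally have "E j ** F = c j \<cdot>\<^sub>m E j" using that by simp
    with 1 show ?thesis by blast
  qed
  have cases01: "F ** E j = 0 \<and> E j ** F = 0 \<or> F ** E j = E j \<and> E j ** F = E j"
    if "F \<in> B" "F ** F = F" "j \<le> d" for F j
  proof -
    from absorb[OF \<open>F \<in> B\<close> \<open>j \<le> d\<close>] obtain c
      where c: "F ** E j = c \<cdot>\<^sub>m E j" "E j ** F = c \<cdot>\<^sub>m E j" by blast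
    \<comment> \<open>Idempotency of \<open>F\<close> forces its eigenvalue \<open>c\<close> on
      \<open>E j\<close> to satisfy \<open>c = c * c\<close>.\<close>
    have "c \<cdot>\<^sub>m E j = (F ** F) ** E j" by (simp add: that c)
    also have "\<dots> = (c * c) \<cdot>\<^sub>m E j"
      by (simp add: c matrix_mult_smult smult_smult_mat flip: matrix_mul_assoc)
    finally have eq: "c \<cdot>\<^sub>m E j = (c * c) \<cdot>\<^sub>m E j" .
    obtain x y where "E j $ x $ y \<noteq> 0"
      using nonzero[OF \<open>j \<le> d\<close>] by (auto simp: vec_eq_iff)
    moreover have "c * E j $ x $ y = c * c * E j $ x $ y"
      using arg_cong[OF eq, of "\<lambda>M. M $ x $ y"] by simp
    ultimately have "c = 0 \<or> c = 1" by simp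
    then show ?thesis using c by (auto simp: one_smult_mat zero_smult_mat)
  qed
  show ?thesis
  proof
    assume prim: "primitive_idempotent B F"
    then have F: "F \<in> B" "F \<noteq> 0" "F ** F = F"
      by (simp_all add: primitive_idempotent_def)
    have "\<exists>j\<le>d. F ** E j \<noteq> 0"
    proof (rule ccontr)
      assume neg: "\<not> ?thesis"
      from \<open>F \<in> B\<close> obtain c where c: "F = (\<Sum>i\<le>d. c i \<cdot>\<^sub>m E i)"
        unfolding span by blast
      have "F ** F = (\<Sum>i\<le>d. c i \<cdot>\<^sub>m (F ** E i))"
        \<comment> \<open>Only the right factor is expanded, so that each summand contains a product
          \<open>F ** E i\<close>, which vanishes by assumption.\<close>
        by (subst (2) c) (simp add: matrix_mult_sum matrix_mult_smult)
      also have "\<dots> = 0" using neg by (intro sum.neutral) (auto simp: smult_zero_mat)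
      finally show False using F by simp
    qed
    then obtain j where j: "j \<le> d" "F ** E j = E j" "E j ** F = E j"
      using cases01[OF F(1,3)] by blast
    obtain c where c: "F = (\<Sum>i\<le>d. c i \<cdot>\<^sub>m E i)"
      using \<open>F \<in> B\<close> unfolding span by blast
    obtain e where e: "E j = (\<Sum>i\<le>d. e i \<cdot>\<^sub>m E i)"
      using in_B[OF j(1)] unfolding span by blast
    have "F - E j = (\<Sum>i\<le>d. (c i - e i) \<cdot>\<^sub>m E i)"
      by (subst c, subst e) (rule matrix_eqI, simp add: sum_subtractf algebra_simps)
    then have G: "F - E j \<in> B"
      unfolding span by (intro range_eqI[where x = "\<lambda>i. c i - e i"])
    \<comment> \<open>Removing \<open>E j\<close> from \<open>F\<close> leaves an idempotent
      orthogonal to it; being a splitting of the primitive \<open>F\<close>, it must be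
      trivial.\<close>
    have "(F - E j) ** (F - E j) = F - E j" "E j ** (F - E j) = 0" "(F - E j) ** E j = 0"
      "F = E j + (F - E j)"
      using F j orth[of j j] by (simp_all add: matrix_diff_ldistrib matrix_diff_rdistrib)
    then have "F - E j = 0"
      using prim G in_B[OF j(1)] nonzero[OF j(1)] orth[of j j] j(1)
      unfolding primitive_idempotent_def by metis
    then show "F \<in> E ` {..d}" using j(1) by auto
  next
    assume "F \<in> E ` {..d}"
    then obtain j where j: "j \<le> d" "F = E j" by auto
    have False if "G \<in> B" "H \<in> B" "G \<noteq> 0" "H \<noteq> 0" "G ** G = G" "H ** H = H"
      "G ** H = 0" "H ** G = 0" "E j = G + H" for G H
    proof -
      have "E j ** G = G" using that by (simp add: matrix_add_rdistrib_complex)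
      then have "G = E j" using cases01[OF that(1,5) j(1)] \<open>G \<noteq> 0\<close> by auto
      then show False using that by simp
    qed
    then show "primitive_idempotent B F"
      using j in_B nonzero orth[of j j] unfolding primitive_idempotent_def by auto
  qed
qed

text \<open>Each family is expanded in the other, which gives the two inclusions; the coefficients
  come from exchanging the order of summation.\<close>

lemma bose_mesner_eq_span_idempotents:
  assumes E: "\<And>j. j \<le> d \<Longrightarrow> E j = c \<cdot>\<^sub>m (\<Sum>i\<le>d. Q i j \<cdot>\<^sub>m A i)"
    and A: "\<And>j. j \<le> d \<Longrightarrow> A j = (\<Sum>i\<le>d. P i j \<cdot>\<^sub>m E i)"
  shows "bose_mesner d A = range (\<lambda>c. \<Sum>i\<le>d. c i \<cdot>\<^sub>m E i)"
proof -
  have swap: "(\<Sum>j\<le>d. a j \<cdot>\<^sub>m (\<Sum>i\<le>d. R i j \<cdot>\<^sub>m M i)) = (\<Sum>i\<le>d. (\<Sum>j\<le>d. a j * R i j) \<cdot>\<^sub>m M i)"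
    for a R and M :: "nat \<Rightarrow> complex^'a^'a"
    by (simp add: smult_sum_mat smult_smult_mat flip: sum_smult_mat) (rule sum.swap)
  have A_E: "(\<Sum>j\<le>d. a j \<cdot>\<^sub>m A j) = (\<Sum>i\<le>d. (\<Sum>j\<le>d. a j * P i j) \<cdot>\<^sub>m E i)" for a
    by (subst swap[symmetric]) (simp add: A)
  have E_A: "(\<Sum>j\<le>d. a j \<cdot>\<^sub>m E j) = (\<Sum>i\<le>d. (\<Sum>j\<le>d. a j * c * Q i j) \<cdot>\<^sub>m A i)" for a
    by (subst swap[symmetric]) (simp add: E smult_smult_mat)
  have "bose_mesner d A = range (\<lambda>a. \<Sum>i\<le>d. a i \<cdot>\<^sub>m A i)"
    by (auto simp: bose_mesner_def)
  moreover have "\<dots> \<subseteq> range (\<lambda>a. \<Sum>i\<le>d. a i \<cdot>\<^sub>m E i)"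
    by (rule image_subsetI, subst A_E, rule rangeI)
  moreover have "range (\<lambda>a. \<Sum>i\<le>d. a i \<cdot>\<^sub>m E i) \<subseteq> range (\<lambda>a. \<Sum>i\<le>d. a i \<cdot>\<^sub>m A i)"
    by (rule image_subsetI, subst E_A, rule rangeI)
  ultimately show ?thesis by simp
qed

lemma sum_in_Nats: "(\<And>x. x \<in> S \<Longrightarrow> f x \<in> \<nat>) \<Longrightarrow> sum f S \<in> \<nat>"
  by (induction S rule: infinite_finite_induct) auto

text \<open>The zero-one matrices sum to \<open>\<J>\<close>, so their supports partition all
  positions, and a coefficient of a linear combination is its entry at any position of the matching
  support. Closure under products comes from the idempotents, in whose coordinates multiplication is
  componentwise.\<close>

lemma scheme_of_idempotents:
  fixes A E :: "nat \<Rightarrow> complex^'x::finite^'x"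
  assumes zero_one: "\<And>i. i \<le> d \<Longrightarrow> zero_one_mat (A i)"
    and A_nonzero: "\<And>i. i \<le> d \<Longrightarrow> A i \<noteq> 0"
    and A0: "A 0 = mat 1"
    and sum_A: "(\<Sum>i\<le>d. A i) = \<J>"
    and sym: "\<And>i. i \<le> d \<Longrightarrow> transpose (A i) = A i"
    and E: "\<And>j. j \<le> d \<Longrightarrow> E j = (1 / of_nat CARD('x)) \<cdot>\<^sub>m (\<Sum>i\<le>d. Q i j \<cdot>\<^sub>m A i)"
    and A: "\<And>j. j \<le> d \<Longrightarrow> A j = (\<Sum>i\<le>d. P i j \<cdot>\<^sub>m E i)"
    and orth: "\<And>i j. i \<le> d \<Longrightarrow> j \<le> d \<Longrightarrow> E i ** E j = (if i = j then E i else 0)"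
    and mult_nonzero: "\<And>j. j \<le> d \<Longrightarrow> Q 0 j \<noteq> 0"
    and Q_ones: "\<And>i. i \<le> d \<Longrightarrow> Q i 0 = 1"
  shows "symmetric_association_scheme d A" and "idempotent_ordering d A E"
proof -
  have entry: "A i $ x $ y = (if i = h then 1 else 0)"
    if "A h $ x $ y \<noteq> 0" "h \<le> d" "i \<le> d" for i h x y
  proof -
    have re: "Re (A i $ x $ y) \<in> {0, 1} \<and> A i $ x $ y = of_real (Re (A i $ x $ y))" if "i \<le> d" for i
      using zero_one[OF that] unfolding zero_one_mat_def
      by (metis insert_iff one_complex.sel(1) singletonD
          zero_complex.sel(1) of_real_0 of_real_1)
    have h1: "Re (A h $ x $ y) = 1" using re[OF that(2)] that(1) by auto
    \<comment> \<open>Passing to real parts makes order available: nonnegative numbers with sum 1,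
      one of which is 1, leave 0 for all others.\<close>
    have "(\<Sum>i\<le>d. Re (A i $ x $ y)) = 1"
      using arg_cong[OF sum_A, of "\<lambda>M. Re (M $ x $ y)"] by simp
    then have "Re (A h $ x $ y) + (\<Sum>i\<in>{..d} - {h}. Re (A i $ x $ y)) = 1"
      using that(2) by (simp add: sum.remove)
    then have "(\<Sum>i\<in>{..d} - {h}. Re (A i $ x $ y)) = 0" using h1 by simp
    then have "\<forall>i\<in>{..d} - {h}. Re (A i $ x $ y) = 0"
      by (subst (asm) sum_nonneg_eq_0_iff) (use re in force)+
    then show ?thesis using re[OF \<open>i \<le> d\<close>] re[OF \<open>h \<le> d\<close>] h1 that(3) by (cases "i = h") auto
  qed
  have coeff: "(\<Sum>i\<le>d. c i \<cdot>\<^sub>m A i) $ x $ y = c h" if "A h $ x $ y \<noteq> 0" "h \<le> d" for c h x y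
  proof -
    have "(\<Sum>i\<le>d. c i \<cdot>\<^sub>m A i) $ x $ y = (\<Sum>i\<le>d. c i * A i $ x $ y)"
      by simp
    also have "\<dots> = (\<Sum>i\<le>d. if i = h then c i else 0)"
      using entry[OF that] by (intro sum.cong) auto
    finally have "(\<Sum>i\<le>d. c i \<cdot>\<^sub>m A i) $ x $ y = (\<Sum>i\<le>d. if i = h then c i else 0)" .
    then show ?thesis using that(2) by simp
  qed
  have span: "bose_mesner d A = range (\<lambda>c. \<Sum>i\<le>d. c i \<cdot>\<^sub>m E i)"
    using E A by (rule bose_mesner_eq_span_idempotents)
  have E_nonzero: "E j \<noteq> 0" if "j \<le> d" for j
  proof
    fix x :: 'x
    assume "E j = 0"
    \<comment> \<open>A diagonal position lies in the support of \<open>A 0\<close> alone, so the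
      entry there sees only row 0 of \<open>Q\<close>.\<close>
    moreover have "E j $ x $ x = (1 / of_nat CARD('x)) * Q 0 j"
      using coeff[of 0 x x "\<lambda>i. Q i j"] that by (simp add: E A0 mat_def)
    ultimately show False using mult_nonzero[OF that] by simp
  qed
  have "\<exists>p :: nat \<Rightarrow> nat. A i ** A j = (\<Sum>h\<le>d. of_nat (p h) \<cdot>\<^sub>m A h)" if ij: "i \<le> d" "j \<le> d" for i j
  proof -
    have "A i ** A j = (\<Sum>h\<le>d. (P h i * P h j) \<cdot>\<^sub>m E h)"
      using ij by (simp add: A sum_orthogonal_mult[OF orth])
    then have "A i ** A j \<in> bose_mesner d A"
      unfolding span by (intro range_eqI[where x = "\<lambda>h. P h i * P h j"])
    then obtain c where c: "A i ** A j = (\<Sum>h\<le>d. c h \<cdot>\<^sub>m A h)"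
      unfolding bose_mesner_def by blast
    \<comment> \<open>The coefficient is an entry of a product of two zero-one matrices, hence a
      natural number.\<close>
    have "c h \<in> \<nat>" if "h \<le> d" for h
    proof -
      obtain x y where xy: "A h $ x $ y \<noteq> 0"
        using A_nonzero[OF \<open>h \<le> d\<close>] by (auto simp: vec_eq_iff)
      have "A i' $ x' $ y' \<in> \<nat>" if "i' \<le> d" for i' x' y'
        using zero_one[OF that] unfolding zero_one_mat_def by (metis Nats_0 Nats_1 insertE singletonD)
      then have "(A i ** A j) $ x $ y \<in> \<nat>"
        unfolding matrix_mult_nth using ij by (intro sum_in_Nats Nats_mult) auto
      then show ?thesis using coeff[OF xy that] c by simp
    qed
    then have "\<forall>h. \<exists>q. h \<le> d \<longrightarrow> c h = of_nat q"
      by (auto elim: Nats_cases)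
    then obtain p where "\<forall>h. h \<le> d \<longrightarrow> c h = of_nat (p h)"
      by (rule choice[THEN exE])
    with c show ?thesis by (intro exI[of _ p]) simp
  qed
  then have "A i ** A j = (\<Sum>h\<le>d. of_nat ((SOME p. A i ** A j = (\<Sum>h\<le>d. of_nat (p h) \<cdot>\<^sub>m A h)) h) \<cdot>\<^sub>m A h)"
    if "i \<le> d" "j \<le> d" for i j
    using that by (intro someI_ex[where P = "\<lambda>p. A i ** A j = (\<Sum>h\<le>d. of_nat (p h) \<cdot>\<^sub>m A h)"])
  then show "symmetric_association_scheme d A"
    unfolding symmetric_association_scheme_def
    using zero_one A_nonzero A0 sum_A sym
    by (intro conjI allI impI exI[where x = "\<lambda>i j. SOME p. A i ** A j = (\<Sum>h\<le>d. of_nat (p h) \<cdot>\<^sub>m A h)"]) simp_all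
  have "inj_on E {..d}"
  proof (rule inj_onI)
    fix i j assume "i \<in> {..d}" "j \<in> {..d}" "E i = E j"
    then show "i = j" using orth[of i j] orth[of i i] E_nonzero[of i] by (auto split: if_splits)
  qed
  moreover have "E ` {..d} = {F. primitive_idempotent (bose_mesner d A) F}"
    by (rule set_eqI, simp only: mem_Collect_eq primitive_idempotent_iff[OF span orth E_nonzero])
  moreover have "E 0 = (1 / of_nat CARD('x)) \<cdot>\<^sub>m \<J>"
    using Q_ones by (simp add: E one_smult_mat sum_A)
  ultimately show "idempotent_ordering d A E"
    unfolding idempotent_ordering_def bij_betw_def by simp
qed

section \<open>The radicals in the eigenmatrices and the identity QP = 4mn I\<close>

lemma atMost_7: "{..7::nat} = {0, 1, 2, 3, 4, 5, 6, 7}"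
  by auto

text \<open>The radical in the last two rows of \<open>eigP\<close>. It turns out to be the singular
  value of the centred matrix \<open>D\<close> on the vectors summing to zero over every
  block.\<close>

definition gdd_root :: "real \<Rightarrow> real \<Rightarrow> real \<Rightarrow> real" where
  "gdd_root m n k = sqrt (k * (m*n - n - k)) / sqrt ((m - 1) * (n - 1))"

text \<open>The bound on \<open>k\<close> says that \<open>m*n - n - k\<close> is positive, so every
  radical factors into four positive square roots. The last two equations turn the radicals of
  \<open>eigQ\<close> into rational multiples of the reciprocal of \<open>gdd_root\<close>.\<close>

lemma gdd_root:
  assumes m: "m > 1" and n: "n > 1" and k: "k > 0" and lt: "k < (m - 1) * n"
  shows "gdd_root m n k > 0"
    and "gdd_root m n k * gdd_root m n k = k * (m*n - n - k) / ((m - 1) * (n - 1))"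
    and "m * sqrt ((n - 1) * (m*n - n - k)) / sqrt (k * (m - 1)) =
      m * (m*n - n - k) / ((m - 1) * gdd_root m n k)"
    and "m * sqrt (k * (n - 1)) / sqrt ((m - 1) * (m*n - n - k)) = m * k / ((m - 1) * gdd_root m n k)"
proof -
  \<comment> \<open>Taking the four square roots as atoms makes all the claims identities of
    rational functions.\<close>
  define a c d e where "a = sqrt k" "c = sqrt (m*n - n - k)" "d = sqrt (m - 1)" "e = sqrt (n - 1)"
  note sqrts = this
  have pos: "m*n - n - k > 0" using lt by (simp add: algebra_simps)
  have ne: "a > 0" "c > 0" "d > 0" "e > 0"
    and sq: "k = a * a" "m*n - n - k = c * c" "m - 1 = d * d" "n - 1 = e * e"
    using m n k pos by (simp_all add: sqrts)
  have s: "gdd_root m n k = (a * c) / (d * e)"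
    by (simp add: gdd_root_def sqrts real_sqrt_mult)
  show "gdd_root m n k > 0" using ne by (simp add: s)
  show "gdd_root m n k * gdd_root m n k = k * (m*n - n - k) / ((m - 1) * (n - 1))"
    using ne unfolding s sq(2-4) by (simp add: sq(1) field_simps)
  have "m * (e * c) / (a * d) = m * (c * c) / ((d * d) * gdd_root m n k)"
    using ne by (simp add: s field_simps)
  then show "m * sqrt ((n - 1) * (m*n - n - k)) / sqrt (k * (m - 1)) =
      m * (m*n - n - k) / ((m - 1) * gdd_root m n k)"
    using m k pos by (simp add: sqrts real_sqrt_mult flip: sq)
  have "m * (a * e) / (d * c) = m * (a * a) / ((d * d) * gdd_root m n k)"
    using ne by (simp add: s field_simps)
  then show "m * sqrt (k * (n - 1)) / sqrt ((m - 1) * (m*n - n - k)) = m * k / ((m - 1) * gdd_root m n k)"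
    using m k pos by (simp add: sqrts real_sqrt_mult flip: sq)
qed

text \<open>In every entry of the product the radicals occur only in the combinations
  \<open>S * s\<close>, \<open>t * s\<close> and in \<open>sqrt k\<close> against itself, all of
  which are rational, or they cancel with opposite signs.\<close>

lemma eigQ_eigP:
  fixes m n k :: real
  assumes m: "m > 1" and n: "n > 1" and k: "k > 0" and lt: "k < (m - 1) * n"
    and l: "l \<le> 7" and j: "j \<le> 7"
  shows "(\<Sum>i\<le>7. eigQ m n k l i * eigP m n k i j) = (if l = j then 4 * (m * n) else 0)"
proof -
  define r where "r = sqrt k"
  define s where "s = sqrt (k * (m*n - n - k)) / sqrt ((m - 1) * (n - 1))"
  define S where "S = m * sqrt ((n - 1) * (m*n - n - k)) / sqrt (k * (m - 1))"
  define t where "t = m * sqrt (k * (n - 1)) / sqrt ((m - 1) * (m*n - n - k))"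
  have r: "r \<noteq> 0" "k = r * r" using k by (simp_all add: r_def)
  note root = gdd_root[OF m n k lt, unfolded gdd_root_def, folded s_def S_def t_def]
  have Ss: "S * s = m * (m*n - n - k) / (m - 1)" and ts: "t * s = m * k / (m - 1)"
    using root(1) by (simp_all add: root(3,4))
  \<comment> \<open>Both orders of the factors are supplied, since rewriting may produce
    either.\<close>
  note rel = Ss Ss[unfolded mult.commute[of S]] ts ts[unfolded mult.commute[of t]]
  have "l \<in> {0, 1, 2, 3, 4, 5, 6, 7}" "j \<in> {0, 1, 2, 3, 4, 5, 6, 7}" using l j by auto
  then show ?thesis
    unfolding eigP_def eigQ_def Let_def atMost_7 s_def[symmetric] S_def[symmetric]
      t_def[symmetric] r_def[symmetric]
    using m r(1) rel
    \<comment> \<open>The 64 entries go through one pipeline: evaluate, clear denominators, replace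
      \<open>k\<close> by \<open>r * r\<close>, normalise.\<close>
    by (elim insertE emptyE; simp; simp add: divide_simps; simp add: r(2); simp add: algebra_simps)
qed

section \<open>Bipartite block matrices and the splitting along the swap\<close>

definition bipartite_mat ::
    "complex^'a::finite^'a \<Rightarrow> complex^'b::finite^'b \<Rightarrow> complex^'b^'b \<Rightarrow> complex^'b^'b
      \<Rightarrow> complex^('a \<times> 'b + 'a \<times> 'b)^('a \<times> 'b + 'a \<times> 'b)" where
  "bipartite_mat S X Y Z = block_mat (S \<otimes>\<^sub>k X) (S \<otimes>\<^sub>k Y) (S \<otimes>\<^sub>k Z) (S \<otimes>\<^sub>k X)"

definition swap_diff :: "complex^2^2" ("\<Delta>\<^sub>2") where
  "\<Delta>\<^sub>2 = mat 1 - \<Pi>\<^sub>2"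

lemma matrix_eq_sumI:
  fixes M N :: "complex^('c::finite + 'd::finite)^('a::finite + 'b::finite)"
  assumes "\<And>p q. M $ Inl p $ Inl q = N $ Inl p $ Inl q"
    and "\<And>p q. M $ Inl p $ Inr q = N $ Inl p $ Inr q"
    and "\<And>p q. M $ Inr p $ Inl q = N $ Inr p $ Inl q"
    and "\<And>p q. M $ Inr p $ Inr q = N $ Inr p $ Inr q"
  shows "M = N"
proof (rule matrix_eqI)
  fix i j show "M $ i $ j = N $ i $ j"
    using assms by (cases i; cases j) auto
qed

lemma kron_zero: "A \<otimes>\<^sub>k 0 = 0" "0 \<otimes>\<^sub>k B = 0"
  by (rule matrix_eqI, simp)+

lemma block_mat_zero: "block_mat 0 0 0 0 = 0"
  by (rule matrix_eq_sumI) simp_all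

lemma bipartite_mat_mult:
  "bipartite_mat S X Y Z ** bipartite_mat S' X' Y' Z' =
    block_mat ((S ** S') \<otimes>\<^sub>k (X ** X') + (S ** S') \<otimes>\<^sub>k (Y ** Z'))
      ((S ** S') \<otimes>\<^sub>k (X ** Y') + (S ** S') \<otimes>\<^sub>k (Y ** X'))
      ((S ** S') \<otimes>\<^sub>k (Z ** X') + (S ** S') \<otimes>\<^sub>k (X ** Z'))
      ((S ** S') \<otimes>\<^sub>k (Z ** Y') + (S ** S') \<otimes>\<^sub>k (X ** X'))"
  by (simp add: bipartite_mat_def block_mat_mult kron_matrix_mult)

text \<open>There are two sources of orthogonality: the outer factors \<open>S\<close>,
  \<open>S'\<close> annihilate each other, or all inner blocks do. The scalars \<open>e\<close> and
  \<open>e'\<close> have no influence in either case.\<close>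

lemma bipartite_mat_orthogonal:
  assumes "S ** S' = 0 \<or> X ** X' = 0 \<and> Y ** Z' = 0 \<and> X ** Y' = 0 \<and> Y ** X' = 0 \<and>
    Z ** X' = 0 \<and> X ** Z' = 0 \<and> Z ** Y' = 0"
  shows "bipartite_mat S X (e \<cdot>\<^sub>m Y) (e \<cdot>\<^sub>m Z) ** bipartite_mat S' X' (e' \<cdot>\<^sub>m Y') (e' \<cdot>\<^sub>m Z') = 0"
  using assms
  by (auto simp: bipartite_mat_mult kron_zero smult_matrix_mult matrix_mult_smult smult_zero_mat
      block_mat_zero)

text \<open>Before scaling, the diagonal block of the product is \<open>2 * (1 + e * e')\<close>
  times that of the factor: one 2 comes from \<open>S ** S\<close>, and \<open>X ** X\<close> and
  \<open>Y ** Z\<close> contribute 1 and \<open>e * e'\<close>. The factors \<open>1 / 4\<close>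
  absorb the resulting 4 for equal signs; opposite signs cancel.\<close>

lemma bipartite_mat_idempotent:
  assumes "S ** S = 2 \<cdot>\<^sub>m S"
    and "X ** X = X" "Y ** Z = X" "X ** Y = Y" "Y ** X = Y" "Z ** X = Z" "X ** Z = Z" "Z ** Y = X"
    and "e = 1 \<or> e = -1" "e' = 1 \<or> e' = -1"
  shows "((1 / 4) \<cdot>\<^sub>m bipartite_mat S X (e \<cdot>\<^sub>m Y) (e \<cdot>\<^sub>m Z)) **
      ((1 / 4) \<cdot>\<^sub>m bipartite_mat S X (e' \<cdot>\<^sub>m Y) (e' \<cdot>\<^sub>m Z)) =
    (if e = e' then (1 / 4) \<cdot>\<^sub>m bipartite_mat S X (e \<cdot>\<^sub>m Y) (e \<cdot>\<^sub>m Z) else 0)"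
  unfolding smult_matrix_mult matrix_mult_smult bipartite_mat_mult assms(1-8)
  using assms(9,10) by (intro matrix_eq_sumI) (auto simp: bipartite_mat_def)

lemma all_ones_2_mult: "(\<J> :: complex^2^2) ** \<J> = 2 \<cdot>\<^sub>m \<J>"
  by (simp add: all_ones_mult)

lemma swap_diff_nth [simp]: "\<Delta>\<^sub>2 $ i $ j = (if i = j then 1 else -1)"
  by (simp add: swap_diff_def mat_def)

lemma swap_diff_mult:
  "\<Delta>\<^sub>2 ** \<Delta>\<^sub>2 = 2 \<cdot>\<^sub>m \<Delta>\<^sub>2" "\<Delta>\<^sub>2 ** \<J> = (0 :: complex^2^2)" "\<J> ** \<Delta>\<^sub>2 = (0 :: complex^2^2)"
proof -
  have sum: "(\<Sum>k\<in>UNIV. f k) = f 1 + f 2" for f :: "2 \<Rightarrow> complex"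
    by (simp add: UNIV_2)
  have "(\<Delta>\<^sub>2 ** \<Delta>\<^sub>2) $ i $ j = (2 \<cdot>\<^sub>m \<Delta>\<^sub>2) $ i $ j" "(\<Delta>\<^sub>2 ** (\<J> :: complex^2^2)) $ i $ j = 0"
    "((\<J> :: complex^2^2) ** \<Delta>\<^sub>2) $ i $ j = 0" for i j
    using exhaust_2[of i] exhaust_2[of j] by (auto simp: matrix_mult_nth sum)
  then show "\<Delta>\<^sub>2 ** \<Delta>\<^sub>2 = 2 \<cdot>\<^sub>m \<Delta>\<^sub>2" "\<Delta>\<^sub>2 ** \<J> = (0 :: complex^2^2)"
    "\<J> ** \<Delta>\<^sub>2 = (0 :: complex^2^2)"
    by (intro matrix_eqI; simp)+
qed

text \<open>Substituting I = (J + \<Delta>)/2 and \<Pi> = (J - \<Delta>)/2 for the 2 by 2 factors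
  separates the two components: the one at \<open>\<J>\<close> sees the sums of the coefficients and
  \<open>W1 + W2\<close>, the one at \<open>\<Delta>\<^sub>2\<close> sees the differences and
  \<open>W1 - W2\<close>. The matrices built on \<open>\<J>\<close> alone get a factor 2 to offset
  the overall half.\<close>

lemma sum_scheme_mats:
  fixes W1 W2 :: "complex^('m::finite \<times> 'n::finite)^('m \<times> 'n)"
  defines "A \<equiv> W1 + W2"
  shows "(\<Sum>i\<le>7. q i \<cdot>\<^sub>m scheme_mats W1 W2 i) =
    (1 / 2) \<cdot>\<^sub>m (bipartite_mat \<J>
        ((q 0 + q 1) \<cdot>\<^sub>m mat 1 + (2 * q 2) \<cdot>\<^sub>m (\<J>\<^sub>b - mat 1) + (2 * q 3) \<cdot>\<^sub>m (\<J> - \<J>\<^sub>b))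
        ((q 4 + q 5) \<cdot>\<^sub>m A + (2 * q 6) \<cdot>\<^sub>m (\<J> - A - \<J>\<^sub>b) + (2 * q 7) \<cdot>\<^sub>m \<J>\<^sub>b)
        ((q 4 + q 5) \<cdot>\<^sub>m transpose A + (2 * q 6) \<cdot>\<^sub>m (\<J> - transpose A - \<J>\<^sub>b) + (2 * q 7) \<cdot>\<^sub>m \<J>\<^sub>b) +
      bipartite_mat \<Delta>\<^sub>2 ((q 0 - q 1) \<cdot>\<^sub>m mat 1)
        ((q 4 - q 5) \<cdot>\<^sub>m (W1 - W2)) ((q 4 - q 5) \<cdot>\<^sub>m transpose (W1 - W2)))"
  unfolding atMost_7 A_def
proof (rule matrix_eq_sumI, goal_cases)
  case (1 p q)
  then show ?case
    by (cases "fst p = fst q"; cases "snd p = snd q")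
      (simp_all add: scheme_mats_def Let_def bipartite_mat_def mat_def prod_eq_iff field_simps)
next
  case (2 p q)
  then show ?case
    by (cases "fst p = fst q") (simp_all add: scheme_mats_def Let_def bipartite_mat_def mat_def field_simps)
next
  case (3 p q)
  then show ?case
    by (cases "fst p = fst q") (simp_all add: scheme_mats_def Let_def bipartite_mat_def mat_def field_simps)
next
  case (4 p q)
  then show ?case
    by (cases "fst p = fst q"; cases "snd p = snd q")
      (simp_all add: scheme_mats_def Let_def bipartite_mat_def mat_def prod_eq_iff field_simps)
qed

section \<open>The centred incidence matrix of the design\<close>

lemma mult_complement_block_ones:
  fixes A :: "complex^('m::finite \<times> 'n::finite)^('m \<times> 'n)"
  assumes A_Jb: "A ** \<J>\<^sub>b = \<kappa> \<cdot>\<^sub>m (\<J> - \<J>\<^sub>b)"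
  shows "A ** \<J> = (\<kappa> * (of_nat CARD('m) - 1)) \<cdot>\<^sub>m (\<J> :: complex^('m \<times> 'n)^('m \<times> 'n))"
proof -
  \<comment> \<open>As \<open>\<J>\<^sub>b ** \<J>\<close> is n times \<open>\<J>\<close>, the
    product of \<open>A\<close> with \<open>\<J>\<close> can be read off from the one with
    \<open>\<J>\<^sub>b\<close>.\<close>
  have "of_nat CARD('n) \<cdot>\<^sub>m (A ** \<J>) = (A ** \<J>\<^sub>b) ** (\<J> :: complex^('m \<times> 'n)^('m \<times> 'n))"
    by (simp add: matrix_mult_smult block_ones_mult flip: matrix_mul_assoc)
  also have "\<dots> = \<kappa> \<cdot>\<^sub>m (of_nat CARD('m \<times> 'n) \<cdot>\<^sub>m \<J> - of_nat CARD('n) \<cdot>\<^sub>m \<J>)"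
    by (simp only: A_Jb smult_matrix_mult matrix_diff_rdistrib all_ones_mult block_ones_mult)
  finally have eq: "of_nat CARD('n) \<cdot>\<^sub>m (A ** \<J>) = \<dots>" .
  show ?thesis
  proof (rule matrix_eqI)
    fix p q
    show "(A ** \<J>) $ p $ q = ((\<kappa> * (of_nat CARD('m) - 1)) \<cdot>\<^sub>m (\<J> :: complex^('m \<times> 'n)^('m \<times> 'n))) $ p $ q"
    proof -
      have "of_nat CARD('n) * (A ** \<J>) $ p $ q = of_nat CARD('n) * (\<kappa> * (of_nat CARD('m) - 1))"
        using arg_cong[OF eq, of "\<lambda>M. M $ p $ q"] by (simp add: algebra_simps)
      then show ?thesis by simp
    qed
  qed
qed

text \<open>The Gram matrix of \<open>D\<close> is a combination of \<open>mat 1\<close>,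
  \<open>\<J>\<^sub>b\<close> and \<open>\<J>\<close> that is annihilated by
  \<open>\<J>\<^sub>b\<close>, which forces it to be a multiple of the projection in the conclusion.
  The hypothesis on \<open>s\<close> is the comparison of diagonal entries. The scalar called
  \<open>s\<close> here is the square of the singular value.\<close>

lemma centred_gram:
  fixes A :: "complex^('m::finite \<times> 'n::finite)^('m \<times> 'n)"
  assumes A_Jb: "A ** \<J>\<^sub>b = \<kappa> \<cdot>\<^sub>m (\<J> - \<J>\<^sub>b)"
    and At_Jb: "transpose A ** \<J>\<^sub>b = \<kappa> \<cdot>\<^sub>m (\<J> - \<J>\<^sub>b)"
    and gram: "A ** transpose A = a \<cdot>\<^sub>m mat 1 + b \<cdot>\<^sub>m (\<J>\<^sub>b - mat 1) + g \<cdot>\<^sub>m (\<J> - \<J>\<^sub>b)"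
    and card_m: "CARD('m) \<ge> 2" and card_n: "CARD('n) \<ge> 2"
    and D: "D = A - (\<kappa> / of_nat CARD('n)) \<cdot>\<^sub>m (\<J> - \<J>\<^sub>b)"
    and s: "s * (1 - 1 / of_nat CARD('n)) =
      a - (\<kappa> / of_nat CARD('n)) * \<kappa> * (of_nat CARD('m) - 1)"
  shows "D ** \<J>\<^sub>b = 0" and "D ** \<J> = (0 :: complex^('m \<times> 'n)^('m \<times> 'n))"
    and "D ** transpose D = s \<cdot>\<^sub>m (mat 1 - (1 / of_nat CARD('n)) \<cdot>\<^sub>m \<J>\<^sub>b)"
proof -
  \<comment> \<open>Each row of \<open>A\<close> has sum \<kappa> over every block other than its
    own, so this is the mean entry there; subtracting it centres \<open>A\<close> blockwise.\<close>
  define \<mu> where "\<mu> = \<kappa> / of_nat CARD('n)"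
  \<comment> \<open>Stated for a general pair so that it serves \<open>D\<close> and its transpose
    alike.\<close>
  have Jb: "X ** \<J>\<^sub>b = 0 \<and> X ** (\<J> :: complex^('m \<times> 'n)^('m \<times> 'n)) = 0"
    if X_Jb: "Y ** \<J>\<^sub>b = \<kappa> \<cdot>\<^sub>m (\<J> - \<J>\<^sub>b)" and X: "X = Y - \<mu> \<cdot>\<^sub>m (\<J> - \<J>\<^sub>b)"
    for X Y :: "complex^('m \<times> 'n)^('m \<times> 'n)"
  proof
    show X0: "X ** \<J>\<^sub>b = 0"
      unfolding X matrix_diff_rdistrib smult_matrix_mult X_Jb block_ones_mult[OF refl]
      by (rule matrix_eqI) (simp add: \<mu>_def)
    have "of_nat CARD('n) \<cdot>\<^sub>m (X ** (\<J> :: complex^('m \<times> 'n)^('m \<times> 'n))) = (X ** \<J>\<^sub>b) ** \<J>"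
      by (simp add: matrix_mult_smult block_ones_mult flip: matrix_mul_assoc)
    then have eq: "of_nat CARD('n) \<cdot>\<^sub>m (X ** (\<J> :: complex^('m \<times> 'n)^('m \<times> 'n))) = 0"
      by (simp add: X0)
    show "X ** (\<J> :: complex^('m \<times> 'n)^('m \<times> 'n)) = 0"
    proof (rule matrix_eqI)
      fix p q show "(X ** (\<J> :: complex^('m \<times> 'n)^('m \<times> 'n))) $ p $ q = 0 $ p $ q"
        using arg_cong[OF eq, of "\<lambda>M. M $ p $ q"] by simp
    qed
  qed
  have D\<mu>: "D = A - \<mu> \<cdot>\<^sub>m (\<J> - \<J>\<^sub>b)" by (simp add: D \<mu>_def)
  have Dt: "transpose D = transpose A - \<mu> \<cdot>\<^sub>m (\<J> - \<J>\<^sub>b)"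
    by (simp add: D\<mu> transpose_diff_mat transpose_smult_mat transpose_all_ones transpose_block_ones)
  show D_Jb: "D ** \<J>\<^sub>b = 0" and D_J: "D ** \<J> = (0 :: complex^('m \<times> 'n)^('m \<times> 'n))"
    using Jb[OF A_Jb D\<mu>] by simp_all
  have Dt_Jb: "transpose D ** \<J>\<^sub>b = 0" using Jb[OF At_Jb Dt] by simp
  define M where "M = D ** transpose D"
  have "(\<J> - \<J>\<^sub>b) ** transpose A = transpose (A ** (\<J> - \<J>\<^sub>b))"
    by (simp add: matrix_transpose_mul transpose_diff_mat transpose_all_ones transpose_block_ones)
  also have "A ** (\<J> - \<J>\<^sub>b) = (\<kappa> * (of_nat CARD('m) - 1)) \<cdot>\<^sub>m \<J> - \<kappa> \<cdot>\<^sub>m (\<J> - \<J>\<^sub>b)"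
    by (simp only: matrix_diff_ldistrib A_Jb mult_complement_block_ones[OF A_Jb])
  also have "transpose \<dots> = \<dots>"
    by (simp add: transpose_diff_mat transpose_smult_mat transpose_all_ones transpose_block_ones)
  finally have comp: "(\<J> - \<J>\<^sub>b) ** transpose A =
      (\<kappa> * (of_nat CARD('m) - 1)) \<cdot>\<^sub>m \<J> - \<kappa> \<cdot>\<^sub>m (\<J> - \<J>\<^sub>b)" .
  \<comment> \<open>The centring term of the right factor is killed by \<open>D\<close>, so only the
    left factor has to be expanded.\<close>
  have "M = D ** transpose A"
    by (simp add: M_def Dt matrix_diff_ldistrib matrix_mult_smult D_J D_Jb smult_zero_mat)
  also have "\<dots> = A ** transpose A - \<mu> \<cdot>\<^sub>m ((\<J> - \<J>\<^sub>b) ** transpose A)"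
    by (simp add: D\<mu> matrix_diff_rdistrib smult_matrix_mult)
  finally have M: "M = A ** transpose A -
      \<mu> \<cdot>\<^sub>m ((\<kappa> * (of_nat CARD('m) - 1)) \<cdot>\<^sub>m \<J> - \<kappa> \<cdot>\<^sub>m (\<J> - \<J>\<^sub>b))"
    by (simp only: comp)
  define \<beta> \<gamma> where "\<beta> = b - g - \<mu> * \<kappa>"
    and "\<gamma> = g - \<mu> * \<kappa> * (of_nat CARD('m) - 1) + \<mu> * \<kappa>"
  have M2: "M = (a - b) \<cdot>\<^sub>m mat 1 + \<beta> \<cdot>\<^sub>m \<J>\<^sub>b + \<gamma> \<cdot>\<^sub>m \<J>"
    unfolding M gram by (rule matrix_eqI) (simp add: \<beta>_def \<gamma>_def algebra_simps)
  have "M ** \<J>\<^sub>b = (a - b) \<cdot>\<^sub>m \<J>\<^sub>b + (\<beta> * of_nat CARD('n)) \<cdot>\<^sub>m \<J>\<^sub>b + (\<gamma> * of_nat CARD('n)) \<cdot>\<^sub>m \<J>"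
    by (simp add: M2 matrix_add_rdistrib_complex smult_matrix_mult block_ones_mult smult_smult_mat)
  moreover have "M ** \<J>\<^sub>b = 0"
    by (simp add: M_def Dt_Jb flip: matrix_mul_assoc)
  ultimately have zero: "(a - b) \<cdot>\<^sub>m \<J>\<^sub>b + (\<beta> * of_nat CARD('n)) \<cdot>\<^sub>m \<J>\<^sub>b +
      (\<gamma> * of_nat CARD('n)) \<cdot>\<^sub>m \<J> = (0 :: complex^('m \<times> 'n)^('m \<times> 'n))"
    by simp
  obtain x y :: 'm where "x \<noteq> y"
    using ex_distinct[OF card_m] by blast
  fix z :: 'n
  \<comment> \<open>A position joining two different blocks sees only \<open>\<J>\<close>; a
    position inside a block then gives the relation for \<beta>.\<close>
  have \<gamma>: "\<gamma> = 0"
    using arg_cong[OF zero, of "\<lambda>M. M $ (x, z) $ (y, z)"] \<open>x \<noteq> y\<close> by simp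
  then have \<beta>: "a - b + \<beta> * of_nat CARD('n) = 0"
    using arg_cong[OF zero, of "\<lambda>M. M $ (x, z) $ (x, z)"] by simp
  have n: "of_nat CARD('n) \<noteq> (0::complex)" "1 - 1 / of_nat CARD('n) \<noteq> (0::complex)"
    using card_n by auto
  have \<beta>': "\<beta> = - (a - b) / of_nat CARD('n)"
    using \<beta> n(1) by (simp add: field_simps add_eq_0_iff)
  \<comment> \<open>The remaining scalar \<open>a - b\<close> is found from a diagonal entry;
    \<open>1 - 1 / n\<close> can be cancelled because n is at least 2.\<close>
  have "(a - b) * (1 - 1 / of_nat CARD('n)) = M $ (x, z) $ (x, z)"
    unfolding M2 by (simp add: \<gamma> \<beta>' mat_def diff_divide_distrib algebra_simps)
  also have "\<dots> = a - \<mu> * \<kappa> * (of_nat CARD('m) - 1)"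
    unfolding M gram by (simp add: mat_def)
  also have "\<dots> = s * (1 - 1 / of_nat CARD('n))"
    using s by (simp add: \<mu>_def)
  finally have "a - b = s" using n(2) by simp
  then show "D ** transpose D = s \<cdot>\<^sub>m (mat 1 - (1 / of_nat CARD('n)) \<cdot>\<^sub>m \<J>\<^sub>b)"
    unfolding M_def[symmetric] M2 by (intro matrix_eqI) (simp add: \<gamma> \<beta>' algebra_simps)
qed

section \<open>Combinations of the scheme matrices lying in a single component\<close>

lemma bipartite_mat_smult:
  "bipartite_mat S (c \<cdot>\<^sub>m X) (c \<cdot>\<^sub>m Y) (c \<cdot>\<^sub>m Z) = c \<cdot>\<^sub>m bipartite_mat S X Y Z"
  by (rule matrix_eq_sumI) (simp_all add: bipartite_mat_def)

lemma bipartite_mat_zero: "bipartite_mat S 0 0 0 = 0"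
  by (simp add: bipartite_mat_def kron_zero block_mat_zero)

text \<open>Equal coefficients on the matrices 0, 1 and on 4, 5 make the \<Delta>-component vanish,
  and the common factor 2 cancels the half.\<close>

lemma sum_scheme_mats_all_ones:
  fixes W1 W2 :: "complex^('m::finite \<times> 'n::finite)^('m \<times> 'n)"
  defines "A \<equiv> W1 + W2"
  assumes "q 1 = q 0" "q 5 = q 4"
    and X: "v \<cdot>\<^sub>m X = q 0 \<cdot>\<^sub>m mat 1 + q 2 \<cdot>\<^sub>m (\<J>\<^sub>b - mat 1) + q 3 \<cdot>\<^sub>m (\<J> - \<J>\<^sub>b)"
    and Y: "v \<cdot>\<^sub>m Y = q 4 \<cdot>\<^sub>m A + q 6 \<cdot>\<^sub>m (\<J> - A - \<J>\<^sub>b) + q 7 \<cdot>\<^sub>m \<J>\<^sub>b"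
    and Z: "v \<cdot>\<^sub>m Z = q 4 \<cdot>\<^sub>m transpose A + q 6 \<cdot>\<^sub>m (\<J> - transpose A - \<J>\<^sub>b) + q 7 \<cdot>\<^sub>m \<J>\<^sub>b"
  shows "(\<Sum>i\<le>7. q i \<cdot>\<^sub>m scheme_mats W1 W2 i) = v \<cdot>\<^sub>m bipartite_mat \<J> X Y Z"
proof -
  have double: "c + c = 2 * c" for c :: complex by simp
  have 2: "(2 * a) \<cdot>\<^sub>m B + (2 * b) \<cdot>\<^sub>m C + (2 * c) \<cdot>\<^sub>m D = 2 \<cdot>\<^sub>m (a \<cdot>\<^sub>m B + b \<cdot>\<^sub>m C + c \<cdot>\<^sub>m D)"
    for a b c and B C D :: "complex^('m \<times> 'n)^('m \<times> 'n)"
    by (rule matrix_eqI) (simp add: algebra_simps)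
  show ?thesis
    unfolding sum_scheme_mats assms(2,3) double 2 diff_self zero_smult_mat bipartite_mat_zero
      add_0_right A_def[symmetric] X[symmetric] Y[symmetric] Z[symmetric] bipartite_mat_smult
      smult_smult_mat
    by simp
qed

text \<open>Dually, opposite coefficients on these pairs and zeros elsewhere make the all-ones
  component vanish.\<close>

lemma sum_scheme_mats_swap_diff:
  assumes "q 1 = - q 0" "q 2 = 0" "q 3 = 0" "q 5 = - q 4" "q 6 = 0" "q 7 = 0"
  shows "(\<Sum>i\<le>7. q i \<cdot>\<^sub>m scheme_mats W1 W2 i) =
    bipartite_mat \<Delta>\<^sub>2 (q 0 \<cdot>\<^sub>m mat 1) (q 4 \<cdot>\<^sub>m (W1 - W2)) (q 4 \<cdot>\<^sub>m transpose (W1 - W2))"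
proof -
  have "c - - c = 2 * c" for c :: complex by simp
  then show ?thesis
    unfolding sum_scheme_mats assms mult_zero_right add.right_inverse zero_smult_mat
      bipartite_mat_zero add_0_left
    by (intro matrix_eq_sumI) (simp_all add: bipartite_mat_def)
qed

section \<open>Zero-one entries, partition, symmetry and nonvanishing of the scheme matrices\<close>

lemma zero_one_block_mat:
  assumes "zero_one_mat A" "zero_one_mat B" "zero_one_mat C" "zero_one_mat D"
  shows "zero_one_mat (block_mat A B C D)"
  unfolding zero_one_mat_def
proof (intro allI)
  fix i j
  show "block_mat A B C D $ i $ j \<in> {0, 1}"
    using assms unfolding zero_one_mat_def by (cases i; cases j) simp_all
qed

lemma zero_one_zero: "zero_one_mat 0"
  by (simp add: zero_one_mat_def)

lemma zero_one_transpose: "zero_one_mat A \<Longrightarrow> zero_one_mat (transpose A)"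
  by (simp add: zero_one_mat_def)

lemma zero_one_kron_all_ones: "zero_one_mat B \<Longrightarrow> zero_one_mat (\<J> \<otimes>\<^sub>k B)"
  by (auto simp: zero_one_mat_def)

lemma zero_one_kron_swap:
  "zero_one_mat B \<Longrightarrow> zero_one_mat C \<Longrightarrow> zero_one_mat (mat 1 \<otimes>\<^sub>k B + \<Pi>\<^sub>2 \<otimes>\<^sub>k C)"
  by (auto simp: zero_one_mat_def mat_def)

text \<open>The hypothesis \<open>block\<close> serves the matrix with index 6: subtracting both the
  support of W and \<open>\<J>\<^sub>b\<close> from \<open>\<J>\<close> gives entries 0 and 1 only
  when the two do not overlap.\<close>

lemma zero_one_scheme_mats:
  fixes W1 W2 :: "complex^('m::finite \<times> 'n::finite)^('m \<times> 'n)"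
  assumes W1: "zero_one_mat W1" and W2: "zero_one_mat W2" and disj: "disjoint_mats W1 W2"
    and block: "\<And>p q. fst p = fst q \<Longrightarrow> (W1 + W2) $ p $ q = 0"
    and i: "i \<le> 7"
  shows "zero_one_mat (scheme_mats W1 W2 i)"
proof -
  have Jb: "zero_one_mat (\<J>\<^sub>b :: complex^('m \<times> 'n)^('m \<times> 'n))"
    "zero_one_mat (\<J>\<^sub>b - mat 1 :: complex^('m \<times> 'n)^('m \<times> 'n))"
    "zero_one_mat (\<J> - \<J>\<^sub>b :: complex^('m \<times> 'n)^('m \<times> 'n))"
    by (auto simp: zero_one_mat_def mat_def)
  have compl: "zero_one_mat (\<J> - W1 - W2 - \<J>\<^sub>b)"
    unfolding zero_one_mat_def
  proof (intro allI)
    fix p q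
    have "W1 $ p $ q \<in> {0, 1}" "W2 $ p $ q \<in> {0, 1}" "W1 $ p $ q = 0 \<or> W2 $ p $ q = 0"
      using W1 W2 disj unfolding zero_one_mat_def disjoint_mats_def by blast+
    then show "(\<J> - W1 - W2 - \<J>\<^sub>b) $ p $ q \<in> {0, 1}"
      using block[of p q] by auto
  qed
  have "transpose (\<J> - W1 - W2 - \<J>\<^sub>b) = \<J> - transpose W1 - transpose W2 - \<J>\<^sub>b"
    by (rule matrix_eqI) simp
  then have compl': "zero_one_mat (\<J> - transpose W1 - transpose W2 - \<J>\<^sub>b)"
    using zero_one_transpose[OF compl] by simp
  have kron: "zero_one_mat (mat 1 \<otimes>\<^sub>k mat 1 :: complex^(2 \<times> 'm \<times> 'n)^(2 \<times> 'm \<times> 'n))"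
    "zero_one_mat (\<Pi>\<^sub>2 \<otimes>\<^sub>k mat 1 :: complex^(2 \<times> 'm \<times> 'n)^(2 \<times> 'm \<times> 'n))"
    by (auto simp: zero_one_mat_def mat_def)
  have "i \<in> {0, 1, 2, 3, 4, 5, 6, 7}" using i by auto
  then show ?thesis
    by (auto simp: scheme_mats_def Let_def
        intro!: zero_one_block_mat zero_one_kron_swap zero_one_kron_all_ones zero_one_transpose
          zero_one_zero kron Jb compl compl' W1 W2)
qed

lemma scheme_mats_0: "scheme_mats W1 W2 0 = mat 1"
  by (rule matrix_eq_sumI) (auto simp: scheme_mats_def Let_def mat_def prod_eq_iff)

lemma sum_scheme_mats_eq_all_ones: "(\<Sum>i\<le>7. scheme_mats W1 W2 i) = \<J>"
proof -
  have "(\<Sum>i\<le>7. scheme_mats W1 W2 i) = 1 \<cdot>\<^sub>m bipartite_mat \<J> \<J> \<J> \<J>"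
    by (subst sum_scheme_mats_all_ones[where q = "\<lambda>_. 1", symmetric])
      (simp_all add: one_smult_mat)
  also have "\<dots> = \<J>"
    by (rule matrix_eq_sumI) (simp_all add: bipartite_mat_def)
  finally show ?thesis .
qed

lemma transpose_scheme_mats:
  assumes "i \<le> 7" shows "transpose (scheme_mats W1 W2 i) = scheme_mats W1 W2 i"
proof -
  have "i \<in> {0, 1, 2, 3, 4, 5, 6, 7}" using assms by auto
  then show ?thesis
    by (intro matrix_eq_sumI) (auto simp: scheme_mats_def Let_def mat_def)
qed

text \<open>One nonzero entry of \<open>W1 + W2\<close> serves both indices 4 and 5: an entry of
  \<open>W1\<close> appears in the first under \<open>mat 1\<close> and in the second under
  \<open>\<Pi>\<^sub>2\<close>, and for \<open>W2\<close> the roles are exchanged. Index 6 needs a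
  position outside both the blocks and the support of W.\<close>

lemma scheme_mats_nonzero:
  fixes W1 W2 :: "complex^('m::finite \<times> 'n::finite)^('m \<times> 'n)"
  assumes card_m: "CARD('m) \<ge> 2" and card_n: "CARD('n) \<ge> 2"
    and W: "(W1 + W2) $ p $ q \<noteq> 0"
    and compl: "(\<J> - (W1 + W2) - \<J>\<^sub>b) $ p' $ q' \<noteq> 0"
    and i: "i \<le> 7"
  shows "scheme_mats W1 W2 i \<noteq> 0"
proof -
  obtain x y :: 'm where xy: "x \<noteq> y" using ex_distinct[OF card_m] by blast
  obtain z t :: 'n where zt: "z \<noteq> t" using ex_distinct[OF card_n] by blast
  have nonzeroI: "M \<noteq> 0" if "M $ a $ b \<noteq> 0" for M :: "complex^'c::finite^'c" and a b
    using that by auto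
  have W': "W1 $ p $ q \<noteq> 0 \<or> W2 $ p $ q \<noteq> 0" using W by auto
  have "i \<in> {0, 1, 2, 3, 4, 5, 6, 7}" using i by auto
  then consider "i = 0" | "i = 1" | "i = 2" | "i = 3" | "i = 4" | "i = 5" | "i = 6" | "i = 7"
    by auto
  then show ?thesis
  proof cases
    case 1
    then show ?thesis
      by (intro nonzeroI[of _ "Inl (1, p)" "Inl (1, p)"]) (simp add: scheme_mats_def Let_def mat_def)
  next
    case 2
    then show ?thesis
      by (intro nonzeroI[of _ "Inl (1, p)" "Inl (2, p)"]) (simp add: scheme_mats_def Let_def mat_def)
  next
    case 3
    then show ?thesis using zt
      by (intro nonzeroI[of _ "Inl (1, x, z)" "Inl (1, x, t)"])
        (simp add: scheme_mats_def Let_def mat_def)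
  next
    case 4
    then show ?thesis using xy
      by (intro nonzeroI[of _ "Inl (1, x, z)" "Inl (1, y, z)"])
        (simp add: scheme_mats_def Let_def mat_def)
  next
    case 5
    from W' show ?thesis
    proof
      assume "W1 $ p $ q \<noteq> 0"
      then show ?thesis using 5
        by (intro nonzeroI[of _ "Inl (1, p)" "Inr (1, q)"]) (simp add: scheme_mats_def Let_def mat_def)
    next
      assume "W2 $ p $ q \<noteq> 0"
      then show ?thesis using 5
        by (intro nonzeroI[of _ "Inl (1, p)" "Inr (2, q)"]) (simp add: scheme_mats_def Let_def mat_def)
    qed
  next
    case 6
    from W' show ?thesis
    proof
      assume "W1 $ p $ q \<noteq> 0"
      then show ?thesis using 6
        by (intro nonzeroI[of _ "Inl (1, p)" "Inr (2, q)"]) (simp add: scheme_mats_def Let_def mat_def)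
    next
      assume "W2 $ p $ q \<noteq> 0"
      then show ?thesis using 6
        by (intro nonzeroI[of _ "Inl (1, p)" "Inr (1, q)"]) (simp add: scheme_mats_def Let_def mat_def)
    qed
  next
    case 7
    then show ?thesis using compl
      by (intro nonzeroI[of _ "Inl (1, p')" "Inr (1, q')"])
        (simp add: scheme_mats_def Let_def diff_diff_eq)
  next
    case 8
    then show ?thesis
      by (intro nonzeroI[of _ "Inl (1, p)" "Inr (1, p)"]) (simp add: scheme_mats_def Let_def)
  qed
qed

section \<open>The eight orthogonal idempotents and the inversion of their expansion\<close>

lemma scheme_idempotents:
  fixes W1 W2 :: "complex^('m::finite \<times> 'n::finite)^('m \<times> 'n)" and k :: nat
    and E :: "nat \<Rightarrow> complex^(2 \<times> ('m \<times> 'n) + 2 \<times> ('m \<times> 'n))^(2 \<times> ('m \<times> 'n) + 2 \<times> ('m \<times> 'n))"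
  defines "A \<equiv> W1 + W2" and "W \<equiv> W1 - W2"
    and "M \<equiv> real CARD('m)" and "N \<equiv> real CARD('n)" and "\<kappa> \<equiv> of_nat k / (of_nat CARD('m) - 1)"
  assumes card_m: "CARD('m) \<ge> 2" and card_n: "CARD('n) \<ge> 2" and k: "k > 0"
    and lt: "real k < (M - 1) * N"
    and W: "W ** transpose W = of_nat k \<cdot>\<^sub>m mat 1" "transpose W ** W = of_nat k \<cdot>\<^sub>m mat 1"
    and A_Jb: "A ** \<J>\<^sub>b = \<kappa> \<cdot>\<^sub>m (\<J> - \<J>\<^sub>b)" "transpose A ** \<J>\<^sub>b = \<kappa> \<cdot>\<^sub>m (\<J> - \<J>\<^sub>b)"
    and gram: "A ** transpose A = of_nat k \<cdot>\<^sub>m mat 1 + b \<cdot>\<^sub>m (\<J>\<^sub>b - mat 1) + g \<cdot>\<^sub>m (\<J> - \<J>\<^sub>b)"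
    and normal: "transpose A ** A = A ** transpose A"
    and E: "\<And>j. E j = (1 / of_real (4 * (M * N))) \<cdot>\<^sub>m
      (\<Sum>i\<le>7. complex_of_real (eigQ M N (real k) i j) \<cdot>\<^sub>m scheme_mats W1 W2 i)"
    and ij: "i \<le> 7" "j \<le> 7"
  shows "E i ** E j = (if i = j then E i else 0)"
proof -
  let ?J = "\<J> :: complex^('m \<times> 'n)^('m \<times> 'n)"
  let ?Jb = "\<J>\<^sub>b :: complex^('m \<times> 'n)^('m \<times> 'n)"
  define s r where "s = complex_of_real (gdd_root M N (real k))" and "r = complex_of_real (sqrt (real k))"
  define D where "D = A - (\<kappa> / of_nat CARD('n)) \<cdot>\<^sub>m (?J - ?Jb)"
  \<comment> \<open>The projections onto the constant vectors, the block-constant vectors of sum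
    zero, and the vectors of sum zero on every block.\<close>
  define P0 P1 P2 where "P0 = (1 / (of_nat CARD('m) * of_nat CARD('n))) \<cdot>\<^sub>m ?J"
    and "P1 = (1 / of_nat CARD('n)) \<cdot>\<^sub>m ?Jb - (1 / (of_nat CARD('m) * of_nat CARD('n))) \<cdot>\<^sub>m ?J"
    and "P2 = mat 1 - (1 / of_nat CARD('n)) \<cdot>\<^sub>m ?Jb"
  note P_defs = P0_def P1_def P2_def
  have MN: "M > 1" "N > 1" "real k > 0" using card_m card_n k by (simp_all add: M_def N_def)
  note root = gdd_root[OF MN lt]
  have s: "s \<noteq> 0" and r: "r \<noteq> 0" "r * r = of_nat k"
    using root(1) k by (simp_all add: s_def r_def flip: of_real_mult)
  \<comment> \<open>This is the diagonal condition of \<open>centred_gram\<close>, with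
    \<open>s * s\<close> as its scalar.\<close>
  have ss: "s * s * (1 - 1 / of_nat CARD('n)) =
      of_nat k - (\<kappa> / of_nat CARD('n)) * \<kappa> * (of_nat CARD('m) - 1)"
  proof -
    have "gdd_root M N k * gdd_root M N k * (1 - 1 / N) =
        k - ((k / (M - 1)) / N) * (k / (M - 1)) * (M - 1)"
      unfolding root(2) using MN by (simp add: divide_simps) (simp add: algebra_simps)
    from arg_cong[OF this, of complex_of_real] show ?thesis
      by (simp add: s_def \<kappa>_def M_def N_def)
  qed
  have mults: "?J ** ?J = of_nat CARD('m \<times> 'n) \<cdot>\<^sub>m ?J" "?J ** ?Jb = of_nat CARD('n) \<cdot>\<^sub>m ?J"
    "?Jb ** ?J = of_nat CARD('n) \<cdot>\<^sub>m ?J" "?Jb ** ?Jb = of_nat CARD('n) \<cdot>\<^sub>m ?Jb"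
    by (simp_all only: block_ones_mult[OF refl] all_ones_mult)
  have Dt: "transpose D = transpose A - (\<kappa> / of_nat CARD('n)) \<cdot>\<^sub>m (?J - ?Jb)"
    by (simp add: D_def transpose_diff_mat transpose_smult_mat transpose_all_ones transpose_block_ones)
  \<comment> \<open>Normality gives the transpose the same Gram matrix, so the centring argument
    applies to \<open>transpose D\<close> too.\<close>
  have gram': "transpose A ** transpose (transpose A) =
      of_nat k \<cdot>\<^sub>m mat 1 + b \<cdot>\<^sub>m (\<J>\<^sub>b - mat 1) + g \<cdot>\<^sub>m (\<J> - \<J>\<^sub>b)"
    by (simp add: normal gram)
  note D1 = centred_gram[OF A_Jb(1) A_Jb(2) gram card_m card_n D_def ss]
  have D2: "transpose D ** ?Jb = 0" "transpose D ** ?J = 0"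
    "transpose D ** D = (s * s) \<cdot>\<^sub>m (mat 1 - (1 / of_nat CARD('n)) \<cdot>\<^sub>m \<J>\<^sub>b)"
    using centred_gram[OF A_Jb(2) _ gram' card_m card_n Dt ss] A_Jb(1) by simp_all
  have D3: "?Jb ** D = 0" "?J ** D = 0" "?Jb ** transpose D = 0" "?J ** transpose D = 0"
  proof -
    have zero: "transpose (0 :: complex^('m \<times> 'n)^('m \<times> 'n)) = 0"
      by (rule matrix_eqI) simp
    show "?Jb ** D = 0" "?J ** D = 0" "?Jb ** transpose D = 0" "?J ** transpose D = 0"
      using arg_cong[OF D2(1), of transpose] arg_cong[OF D2(2), of transpose]
        arg_cong[OF D1(1), of transpose] arg_cong[OF D1(2), of transpose]
      by (simp_all add: matrix_transpose_mul transpose_all_ones transpose_block_ones zero)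
  qed
  have P: "P0 ** P0 = P0" "P0 ** P1 = 0" "P0 ** P2 = 0" "P1 ** P0 = 0" "P1 ** P1 = P1" "P1 ** P2 = 0"
    "P2 ** P0 = 0" "P2 ** P1 = 0" "P2 ** P2 = P2"
    by (auto simp: P_defs matrix_diff_ldistrib matrix_diff_rdistrib smult_matrix_mult
        matrix_mult_smult mults smult_smult_mat diff_divide_distrib intro!: matrix_eqI)
  have DP: "D ** P0 = 0" "D ** P1 = 0" "D ** P2 = D" "P0 ** D = 0" "P1 ** D = 0" "P2 ** D = D"
    "transpose D ** P0 = 0" "transpose D ** P1 = 0" "transpose D ** P2 = transpose D"
    "P0 ** transpose D = 0" "P1 ** transpose D = 0" "P2 ** transpose D = transpose D"
    "D ** transpose D = (s * s) \<cdot>\<^sub>m P2" "transpose D ** D = (s * s) \<cdot>\<^sub>m P2"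
    by (simp_all add: P_defs matrix_diff_ldistrib matrix_diff_rdistrib smult_matrix_mult
        matrix_mult_smult D1 D2 D3 smult_zero_mat)
  \<comment> \<open>The index \<open>c\<close> runs over the four triples, with \<open>Z c\<close>
    the transpose of \<open>Y c\<close>; the argument \<open>e\<close> of \<open>F\<close> below is
    the sign of the off-diagonal blocks.\<close>
  define S :: "nat \<Rightarrow> complex^2^2" where "S c = (if c = 3 then \<Delta>\<^sub>2 else \<J>)" for c
  define X where "X c = [P0, P1, P2, mat 1] ! c" for c
  define Y where "Y c = [P0, P1, (1 / s) \<cdot>\<^sub>m D, (1 / r) \<cdot>\<^sub>m W] ! c" for c
  define Z where "Z c = [P0, P1, (1 / s) \<cdot>\<^sub>m transpose D, (1 / r) \<cdot>\<^sub>m transpose W] ! c" for c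
  note XYZ = X_def Y_def Z_def
  define F where "F c e = (1 / 4) \<cdot>\<^sub>m bipartite_mat (S c) (X c) (e \<cdot>\<^sub>m Y c) (e \<cdot>\<^sub>m Z c)" for c e
  have same: "F c e ** F c e' = (if e = e' then F c e else 0)"
    if "c \<in> {0, 1, 2, 3}" "e = 1 \<or> e = -1" "e' = 1 \<or> e' = -1" for c e e'
    unfolding F_def
  proof (rule bipartite_mat_idempotent)
    show "S c ** S c = 2 \<cdot>\<^sub>m S c"
      by (simp add: S_def swap_diff_mult all_ones_2_mult)
    show "X c ** X c = X c" "Y c ** Z c = X c" "X c ** Y c = Y c" "Y c ** X c = Y c"
      "Z c ** X c = Z c" "X c ** Z c = Z c" "Z c ** Y c = X c"
      using that(1) s r(1)
      by (auto simp: XYZ P DP W smult_matrix_mult matrix_mult_smult smult_smult_mat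
          one_smult_mat simp flip: r(2))
  qed (use that in auto)
  have other: "F c e ** F c' e' = 0"
    if "c \<in> {0, 1, 2, 3}" "c' \<in> {0, 1, 2, 3}" "c \<noteq> c'" for c c' e e'
  proof -
    have "bipartite_mat (S c) (X c) (e \<cdot>\<^sub>m Y c) (e \<cdot>\<^sub>m Z c) **
        bipartite_mat (S c') (X c') (e' \<cdot>\<^sub>m Y c') (e' \<cdot>\<^sub>m Z c') = 0"
      using that
      by (intro bipartite_mat_orthogonal)
        (auto simp: S_def XYZ swap_diff_mult P DP smult_matrix_mult matrix_mult_smult smult_zero_mat)
    then show ?thesis
      by (simp add: F_def smult_matrix_mult matrix_mult_smult smult_zero_mat)
  qed
  \<comment> \<open>Triple and sign belonging to each column of \<open>eigQ\<close>: the pairs 0 and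
    5, 2 and 3, 7 and 6, 1 and 4 share a triple, the first of each pair having sign +1.\<close>
  define cl :: "nat \<Rightarrow> nat" where "cl j = [0, 3, 1, 1, 3, 0, 2, 2] ! j" for j
  define sg :: "nat \<Rightarrow> complex" where "sg j = [1, 1, 1, -1, -1, -1, -1, 1] ! j" for j
  have E_F: "E j = F (cl j) (sg j)" if "j \<le> 7" for j
  proof -
    define q where "q i = complex_of_real (eigQ M N (real k) i j)" for i
    have MNc: "of_nat CARD('m) = complex_of_real M" "of_nat CARD('n) = complex_of_real N"
      by (simp_all add: M_def N_def)
    have "M \<noteq> 0" "N \<noteq> 0" "complex_of_real M \<noteq> 1" using MN by auto
    note nz = this
    have mid: "(\<Sum>i\<le>7. q i \<cdot>\<^sub>m scheme_mats W1 W2 i) =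
        (complex_of_real M * complex_of_real N) \<cdot>\<^sub>m
          bipartite_mat (S (cl j)) (X (cl j)) (sg j \<cdot>\<^sub>m Y (cl j)) (sg j \<cdot>\<^sub>m Z (cl j))"
    proof -
      have "j \<in> {1, 4} \<or> j \<in> {0, 5} \<or> j \<in> {2, 3} \<or> j \<in> {6, 7}" using that by auto
      then consider "j \<in> {1, 4}" | "j \<in> {0, 5}" | "j \<in> {2, 3}" | "j \<in> {6, 7}" by blast
      then show ?thesis
      proof cases
        case 1
        then have "q 1 = - q 0" "q 2 = 0" "q 3 = 0" "q 5 = - q 4" "q 6 = 0" "q 7 = 0"
          by (auto simp: q_def eigQ_def Let_def)
        note sum_scheme_mats_swap_diff[where q = q, OF this]
        also have "q 0 = complex_of_real M * complex_of_real N"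
          and "q 4 = complex_of_real M * complex_of_real N * (sg j * (1 / r))"
          using 1 by (auto simp: q_def eigQ_def Let_def sg_def r_def)
        ultimately show ?thesis
          using 1 by (auto simp: S_def XYZ cl_def W_def smult_smult_mat simp flip: bipartite_mat_smult)
      next
        case 2
        define u where "u = (if j = 0 then 1 else -1 :: real)"
        have "S (cl j) = \<J>" "X (cl j) = P0" "Y (cl j) = P0" "Z (cl j) = P0" "sg j = complex_of_real u"
          using 2 by (auto simp: S_def XYZ cl_def sg_def u_def)
        note cls = this
        have "q 0 = 1" "q 1 = 1" "q 2 = 1" "q 3 = 1" "q 4 = u" "q 5 = u" "q 6 = u" "q 7 = u"
          using 2 by (auto simp: q_def eigQ_def Let_def u_def)
        note q = this
        show ?thesis
          unfolding cls
          by (subst sum_scheme_mats_all_ones[where v = "complex_of_real M * complex_of_real N"])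
            (auto intro!: matrix_eqI simp del: One_nat_def simp: q P_defs MNc nz mat_def field_simps)
      next
        case 3
        define u where "u = (if j = 2 then 1 else -1 :: real)"
        have "S (cl j) = \<J>" "X (cl j) = P1" "Y (cl j) = P1" "Z (cl j) = P1" "sg j = complex_of_real u"
          using 3 by (auto simp: S_def XYZ cl_def sg_def u_def)
        note cls = this
        have "q 0 = M - 1" "q 1 = M - 1" "q 2 = M - 1" "q 3 = - 1" "q 4 = - u" "q 5 = - u" "q 6 = - u"
          "q 7 = u * (M - 1)"
          using 3 by (auto simp: q_def eigQ_def Let_def u_def)
        note q = this
        show ?thesis
          unfolding cls
          by (subst sum_scheme_mats_all_ones[where v = "complex_of_real M * complex_of_real N"])
            (auto intro!: matrix_eqI simp del: One_nat_def simp: q P_defs MNc nz mat_def field_simps)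
      next
        case 4
        define u where "u = (if j = 6 then -1 else 1 :: real)"
        have "S (cl j) = \<J>" "X (cl j) = P2" "Y (cl j) = (1 / s) \<cdot>\<^sub>m D"
          "Z (cl j) = (1 / s) \<cdot>\<^sub>m transpose D" "sg j = complex_of_real u"
          using 4 by (auto simp: S_def XYZ cl_def sg_def u_def)
        note cls = this
        have q: "q 0 = M * (N - 1)" "q 1 = M * (N - 1)" "q 2 = - M" "q 3 = 0" "q 5 = q 4" "q 7 = 0"
          using 4 by (auto simp: q_def eigQ_def Let_def)
        have "q 4 = u * (M * (M*N - N - k) / ((M - 1) * gdd_root M N k))"
          "q 6 = - u * (M * k / ((M - 1) * gdd_root M N k))"
          using 4 by (auto simp: q_def eigQ_def Let_def root u_def)
        \<comment> \<open>The difference \<open>q 4 - q 6\<close> is \<open>u * M * N / s\<close>,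
          the coefficient of \<open>A\<close>, and \<open>q 6\<close> is the coefficient that the
          centring term gives to the complement of the blocks.\<close>
        then have q': "q 4 = u * (M * (M*N - N - k) / ((M - 1) * s))"
          "q 6 = - u * (M * k / ((M - 1) * s))"
          by (simp_all add: s_def)
        \<comment> \<open>Writing M as \<open>h + 1\<close> makes the denominator
          \<open>M - 1\<close> an atom known to be nonzero.\<close>
        define h where "h = complex_of_real M - 1"
        have Mh: "complex_of_real M = h + 1" "h \<noteq> 0" "h + 1 \<noteq> 0"
          using nz by (simp_all add: h_def)
        show ?thesis
          unfolding cls
          by (subst sum_scheme_mats_all_ones[where v = "complex_of_real M * complex_of_real N"])
            (auto intro!: matrix_eqI simp del: One_nat_def simp: q q' P_defs D_def A_def \<kappa>_def MNc nz s Mh mat_def field_simps)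
      qed
    qed
    show ?thesis
      unfolding E F_def q_def[symmetric] mid using nz by (simp add: smult_smult_mat)
  qed
  have "cl i \<in> {0, 1, 2, 3}" "cl j \<in> {0, 1, 2, 3}" "sg i = 1 \<or> sg i = -1" "sg j = 1 \<or> sg j = -1"
    and inj: "cl i = cl j \<and> sg i = sg j \<longleftrightarrow> i = j"
  proof -
    have "i \<in> {0, 1, 2, 3, 4, 5, 6, 7}" "j \<in> {0, 1, 2, 3, 4, 5, 6, 7}" using ij by auto
    then show "cl i \<in> {0, 1, 2, 3}" "cl j \<in> {0, 1, 2, 3}" "sg i = 1 \<or> sg i = -1" "sg j = 1 \<or> sg j = -1"
      "cl i = cl j \<and> sg i = sg j \<longleftrightarrow> i = j"
      by (auto simp: cl_def sg_def)
  qed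
  then show ?thesis
    using same[of "cl i" "sg i" "sg j"] other[of "cl i" "cl j" "sg i" "sg j"] ij
    by (cases "cl i = cl j") (auto simp: E_F)
qed

text \<open>Inserting the expansions of the \<open>E i\<close> and exchanging the sums leaves
  \<open>c\<close> times the (l, j) entry of QP as the coefficient of \<open>A l\<close>.\<close>

lemma eigenmatrix_inversion:
  fixes A E :: "nat \<Rightarrow> complex^'x::finite^'x"
  assumes E: "\<And>j. E j = c \<cdot>\<^sub>m (\<Sum>i\<le>d. Q i j \<cdot>\<^sub>m A i)"
    and QP: "\<And>l. l \<le> d \<Longrightarrow> c * (\<Sum>i\<le>d. Q l i * P i j) = (if l = j then 1 else 0)"
    and j: "j \<le> d"
  shows "A j = (\<Sum>i\<le>d. P i j \<cdot>\<^sub>m E i)"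
proof -
  have "(\<Sum>i\<le>d. P i j \<cdot>\<^sub>m E i) = (\<Sum>i\<le>d. \<Sum>l\<le>d. (c * (Q l i * P i j)) \<cdot>\<^sub>m A l)"
    by (simp add: E smult_sum_mat smult_smult_mat mult_ac)
  also have "\<dots> = (\<Sum>l\<le>d. (c * (\<Sum>i\<le>d. Q l i * P i j)) \<cdot>\<^sub>m A l)"
    by (subst sum.swap) (simp add: sum_smult_mat sum_distrib_left)
  also have "\<dots> = (\<Sum>l\<le>d. if l = j then A l else 0)"
    by (intro sum.cong) (auto simp: QP one_smult_mat zero_smult_mat)
  finally show ?thesis using j by simp
qed

section \<open>The weighing matrix and the block structure of its absolute value\<close>

lemma abs_mat_diff_disjoint:
  assumes "zero_one_mat W1" "zero_one_mat W2" "disjoint_mats W1 W2"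
  shows "abs_mat (W1 - W2) = W1 + W2"
proof (rule matrix_eqI)
  fix i j
  have "W1 $ i $ j \<in> {0, 1}" "W2 $ i $ j \<in> {0, 1}" "W1 $ i $ j = 0 \<or> W2 $ i $ j = 0"
    using assms unfolding zero_one_mat_def disjoint_mats_def by blast+
  then show "abs_mat (W1 - W2) $ i $ j = (W1 + W2) $ i $ j" by auto
qed

text \<open>For a square matrix a right inverse is also a left inverse; this is applied to W scaled
  by 1/c.\<close>

lemma weighing_matrix_transpose:
  fixes W :: "complex^'x::finite^'x"
  assumes "W ** transpose W = c \<cdot>\<^sub>m mat 1" "c \<noteq> 0"
  shows "transpose W ** W = c \<cdot>\<^sub>m mat 1"
proof -
  have "((1 / c) \<cdot>\<^sub>m W) ** transpose W = mat 1"
    using assms by (simp add: smult_matrix_mult smult_smult_mat one_smult_mat)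
  then have "transpose W ** ((1 / c) \<cdot>\<^sub>m W) = mat 1"
    by (rule matrix_left_right_inverse1)
  then have "c \<cdot>\<^sub>m (1 / c) \<cdot>\<^sub>m (transpose W ** W) = c \<cdot>\<^sub>m mat 1"
    by (simp add: matrix_mult_smult)
  then show ?thesis using assms(2) by (simp add: smult_smult_mat one_smult_mat)
qed

text \<open>Entries 0, 1 and -1 have the same squares as their absolute values. This identifies the
  weight with the parameter k of the design.\<close>

lemma weighing_matrix_weight:
  fixes W :: "complex^'x::finite^'x"
  assumes "weighing_matrix w W"
  shows "(abs_mat W ** transpose (abs_mat W)) $ i $ i = of_nat w"
proof -
  have "abs_mat W $ i $ l * abs_mat W $ i $ l = W $ i $ l * W $ i $ l" for l
  proof -
    have "W $ i $ l \<in> {0, 1, -1}" using assms unfolding weighing_matrix_def by blast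
    then show ?thesis by auto
  qed
  then have "(abs_mat W ** transpose (abs_mat W)) $ i $ i = (W ** transpose W) $ i $ i"
    by (simp add: matrix_mult_nth)
  also have "\<dots> = of_nat w" using assms by (simp add: weighing_matrix_def mat_def)
  finally show ?thesis .
qed

text \<open>The equation says that a row of \<open>A\<close> sums to 0 over its own block and to
  \<kappa> over any other. Nonnegative entries with sum 0 vanish, entries at most 1 bound \<kappa>
  by the block size, and ones everywhere off the blocks would make \<kappa> equal to it.\<close>

lemma zero_one_blocks:
  fixes A :: "complex^('m::finite \<times> 'n::finite)^('m \<times> 'n)"
  assumes card_m: "CARD('m) \<ge> 2" and zero_one: "zero_one_mat A"
    and A_Jb: "A ** \<J>\<^sub>b = of_real \<kappa> \<cdot>\<^sub>m (\<J> - \<J>\<^sub>b)"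
  shows "fst p = fst q \<Longrightarrow> A $ p $ q = 0"
    and "\<kappa> \<le> real CARD('n)"
    and "\<kappa> \<noteq> real CARD('n) \<Longrightarrow> \<exists>p q. (\<J> - A - \<J>\<^sub>b) $ p $ q \<noteq> 0"
proof -
  have re: "A $ p $ q = of_real (Re (A $ p $ q))" "0 \<le> Re (A $ p $ q)" "Re (A $ p $ q) \<le> 1" for p q
  proof -
    have "A $ p $ q \<in> {0, 1}" using zero_one unfolding zero_one_mat_def by blast
    then show "A $ p $ q = of_real (Re (A $ p $ q))" "0 \<le> Re (A $ p $ q)" "Re (A $ p $ q) \<le> 1"
      by auto
  qed
  have row: "(\<Sum>r\<in>UNIV. if fst r = fst q then Re (A $ p $ r) else 0) = (if fst p = fst q then 0 else \<kappa>)"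
    for p q :: "'m \<times> 'n"
    using arg_cong[OF A_Jb, of "\<lambda>M. Re (M $ p $ q)"]
    by (simp add: matrix_mult_nth if_distrib[of Re] if_distrib[of "\<lambda>x. _ * x"] cong: if_cong)
  \<comment> \<open>The block size is read off from an entry of
    \<open>\<J> ** \<J>\<^sub>b\<close>.\<close>
  have count: "(\<Sum>r\<in>(UNIV :: ('m \<times> 'n) set). if fst r = fst q then 1 else 0) = real CARD('n)" for q :: "'m \<times> 'n"
    using arg_cong[OF block_ones_mult(3)[OF refl, where ?'m = 'm and ?'n = 'n], of "\<lambda>M. Re (M $ q $ q)"]
    by (simp add: matrix_mult_nth if_distrib[of Re] cong: if_cong)
  show "A $ p $ q = 0" if "fst p = fst q"
  proof -
    have "(\<Sum>r\<in>UNIV. if fst r = fst q then Re (A $ p $ r) else 0) = 0"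
      using row[of q p] that by simp
    then have "\<forall>r\<in>UNIV. (if fst r = fst q then Re (A $ p $ r) else 0) = 0"
      by (subst (asm) sum_nonneg_eq_0_iff) (auto simp: re(2))
    from bspec[OF this UNIV_I, of q] have "Re (A $ p $ q) = 0" using that by simp
    then show ?thesis using re(1)[of p q] by (metis of_real_0)
  qed
  fix z :: 'n
  obtain x y :: 'm where xy: "x \<noteq> y" using ex_distinct[OF card_m] by blast
  show "\<kappa> \<le> real CARD('n)"
  proof -
    have "\<kappa> = (\<Sum>r\<in>UNIV. if fst r = y then Re (A $ (x, z) $ r) else 0)"
      using row[of "(y, z)" "(x, z)"] xy by simp
    also have "\<dots> \<le> (\<Sum>r\<in>(UNIV :: ('m \<times> 'n) set). if fst r = y then 1 else 0)"
      by (intro sum_mono) (simp add: re(3))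
    also have "\<dots> = real CARD('n)" using count[of "(y, z)"] by simp
    finally show ?thesis .
  qed
  show "\<exists>p q. (\<J> - A - \<J>\<^sub>b) $ p $ q \<noteq> 0" if "\<kappa> \<noteq> real CARD('n)"
  proof (rule ccontr)
    assume "\<not> ?thesis"
    then have zero: "(\<J> - A - \<J>\<^sub>b) $ p $ r = 0" for p r by blast
    have "Re (A $ p $ r) = (if fst p = fst r then 0 else 1)" for p r
      using arg_cong[OF zero[of p r], of Re] by (auto split: if_splits)
    then have "\<kappa> = (\<Sum>r\<in>(UNIV :: ('m \<times> 'n) set). if fst r = y then 1 else 0)"
      using row[of "(y, z)" "(x, z)"] xy by (simp cong: if_cong)
    also have "\<dots> = real CARD('n)" using count[of "(y, z)"] by simp
    finally show False using that by simp
  qed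
qed

section \<open>The scheme and its eigenmatrices\<close>

theorem theorem4p5:
  fixes W W1 W2 :: "complex^('m::finite \<times> 'n::finite)^('m \<times> 'n)"
    and v k m n l1 l2 w :: nat
  assumes weighing: "weighing_matrix w W"
    and qb: "quasi_balanced W"
    and gdd: "symmetric_gdd v k m n l1 l2 (abs_mat W)"
    and k_pos: "k > 0"
    and absW_J: "abs_mat W ** \<J>\<^sub>b = (of_nat k / (of_nat m - 1)) \<cdot>\<^sub>m (\<J> - \<J>\<^sub>b)"
    and J_absW: "\<J>\<^sub>b ** abs_mat W = (of_nat k / (of_nat m - 1)) \<cdot>\<^sub>m (\<J> - \<J>\<^sub>b)"
    and W1: "zero_one_mat W1" and W2: "zero_one_mat W2"
    and disj: "disjoint_mats W1 W2"
    and W_eq: "W = W1 - W2"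
    and k_lt: "k < v"
    and nondegenerate: "k \<noteq> (m - 1) * n"
  shows "symmetric_association_scheme 7 (scheme_mats W1 W2) \<and>
    (\<exists>E. idempotent_ordering 7 (scheme_mats W1 W2) E \<and>
      is_first_eigenmatrix 7 (scheme_mats W1 W2) E
        (\<lambda>i j. complex_of_real (eigP (real m) (real n) (real k) i j)) \<and>
      is_second_eigenmatrix 7 (scheme_mats W1 W2) E
        (\<lambda>i j. complex_of_real (eigQ (real m) (real n) (real k) i j)))"
proof -
  define A where "A = W1 + W2"
  have absW: "abs_mat W = A"
    unfolding A_def W_eq using W1 W2 disj by (rule abs_mat_diff_disjoint)
  have m: "m = CARD('m)" "CARD('m) \<ge> 2" and n: "n = CARD('n)" "CARD('n) \<ge> 2"
    and A_01: "zero_one_mat A" and normal: "transpose A ** A = A ** transpose A"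
    and gram: "A ** transpose A =
      of_nat k \<cdot>\<^sub>m mat 1 + of_nat l1 \<cdot>\<^sub>m (\<J>\<^sub>b - mat 1) + of_nat l2 \<cdot>\<^sub>m (\<J> - \<J>\<^sub>b)"
    using gdd unfolding symmetric_gdd_def absW by auto
  fix p0 :: "'m \<times> 'n"
  have "(of_nat w :: complex) = of_nat k"
    using weighing_matrix_weight[OF weighing, of p0] unfolding absW gram by (simp add: mat_def)
  then have w: "w = k" by simp
  have W_Wt: "(W1 - W2) ** transpose (W1 - W2) = of_nat k \<cdot>\<^sub>m mat 1"
    using weighing unfolding weighing_matrix_def w W_eq by simp
  have Wt_W: "transpose (W1 - W2) ** (W1 - W2) = of_nat k \<cdot>\<^sub>m mat 1"
    using weighing_matrix_transpose[OF W_Wt] k_pos by simp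
  define \<kappa> where "\<kappa> = real k / (real CARD('m) - 1)"
  have \<kappa>: "complex_of_real \<kappa> = of_nat k / (of_nat CARD('m) - 1)" by (simp add: \<kappa>_def)
  have A_Jb: "A ** \<J>\<^sub>b = complex_of_real \<kappa> \<cdot>\<^sub>m (\<J> - \<J>\<^sub>b)"
    using absW_J unfolding absW m(1) \<kappa> .
  have At_Jb: "transpose A ** \<J>\<^sub>b = complex_of_real \<kappa> \<cdot>\<^sub>m (\<J> - \<J>\<^sub>b)"
    using arg_cong[OF J_absW[unfolded absW m(1) \<kappa>[symmetric]], of transpose]
    by (simp add: matrix_transpose_mul transpose_smult_mat transpose_diff_mat transpose_all_ones
        transpose_block_ones)
  \<comment> \<open>With equality, |W| would fill every position off the blocks: the scheme matrix
    with index 6 would be zero and \<open>m*n - n - k\<close>, a denominator in \<open>eigQ\<close>,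
    would vanish.\<close>
  have \<kappa>_ne: "\<kappa> \<noteq> real CARD('n)"
  proof
    assume "\<kappa> = real CARD('n)"
    then have "real k = real ((m - 1) * n)"
      using m n by (simp add: \<kappa>_def field_simps of_nat_diff)
    then show False using nondegenerate by (simp only: of_nat_eq_iff)
  qed
  note blocks = zero_one_blocks[OF m(2) A_01 A_Jb]
  have "\<kappa> < real CARD('n)" using blocks(2) \<kappa>_ne by force
  then have lt: "real k < (real CARD('m) - 1) * real CARD('n)"
    using m(2) by (simp add: \<kappa>_def field_simps)
  obtain p q where compl: "(\<J> - (W1 + W2) - \<J>\<^sub>b) $ p $ q \<noteq> 0"
    using blocks(3)[OF \<kappa>_ne] unfolding A_def by blast
  have "\<exists>q. A $ p0 $ q \<noteq> 0"
  proof (rule ccontr)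
    assume "\<not> ?thesis"
    then have "A $ p0 $ r = 0" for r by blast
    then have "(A ** transpose A) $ p0 $ p0 = 0" by (simp add: matrix_mult_nth)
    then show False using k_pos unfolding gram by (simp add: mat_def)
  qed
  then obtain q' where nonzero: "(W1 + W2) $ p0 $ q' \<noteq> 0" unfolding A_def by blast
  have MNk: "real m > 1" "real n > 1" "real k > 0" "real k < (real m - 1) * real n"
    using m n k_pos lt by simp_all
  define P where "P i j = complex_of_real (eigP (real m) (real n) (real k) i j)" for i j
  define Q where "Q i j = complex_of_real (eigQ (real m) (real n) (real k) i j)" for i j
  \<comment> \<open>Defining \<open>E\<close> through the claimed \<open>Q\<close> makes the second
    eigenmatrix correct by construction; orthogonality and the expansion by \<open>P\<close> remain
    to be shown.\<close>
  define E where "E j = (1 / of_real (4 * (real CARD('m) * real CARD('n)))) \<cdot>\<^sub>m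
    (\<Sum>i\<le>7. Q i j \<cdot>\<^sub>m scheme_mats W1 W2 i)" for j
  have orth: "E i ** E j = (if i = j then E i else 0)" if "i \<le> 7" "j \<le> 7" for i j
    using scheme_idempotents[where E = E and ?W1.0 = W1 and ?W2.0 = W2, OF m(2) n(2) k_pos lt W_Wt Wt_W
        A_Jb[unfolded A_def \<kappa>] At_Jb[unfolded A_def \<kappa>] gram[unfolded A_def] normal[unfolded A_def]
        E_def[unfolded Q_def m(1) n(1)] that] .
  have card: "of_nat CARD(2 \<times> ('m \<times> 'n) + 2 \<times> ('m \<times> 'n)) =
      complex_of_real (4 * (real CARD('m) * real CARD('n)))"
    by simp
  have A_E: "scheme_mats W1 W2 j = (\<Sum>i\<le>7. P i j \<cdot>\<^sub>m E i)" if "j \<le> 7" for j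
    using E_def
  proof (rule eigenmatrix_inversion)
    fix l :: nat
    assume "l \<le> 7"
    have "(\<Sum>i\<le>7. Q l i * P i j) =
        complex_of_real (\<Sum>i\<le>7. eigQ (real m) (real n) (real k) l i * eigP (real m) (real n) (real k) i j)"
      by (simp add: P_def Q_def)
    also have "\<dots> = complex_of_real (if l = j then 4 * (real m * real n) else 0)"
      by (simp only: eigQ_eigP[OF MNk \<open>l \<le> 7\<close> that])
    finally show "1 / of_real (4 * (real CARD('m) * real CARD('n))) * (\<Sum>i\<le>7. Q l i * P i j) =
        (if l = j then 1 else 0)"
      by (simp add: m(1) n(1))
  qed (rule that)
  \<comment> \<open>Row 0 of \<open>Q\<close> consists of the multiplicities, all of them
    positive.\<close>
  have Q0: "Q 0 j \<noteq> 0" if "j \<le> 7" for j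
  proof -
    have "j \<in> {0, 1, 2, 3, 4, 5, 6, 7}" using that by auto
    then show ?thesis using MNk by (auto simp: Q_def eigQ_def Let_def)
  qed
  have Q_ones: "Q i 0 = 1" if "i \<le> 7" for i
  proof -
    have "i \<in> {0, 1, 2, 3, 4, 5, 6, 7}" using that by auto
    then show ?thesis by (auto simp: Q_def eigQ_def Let_def)
  qed
  have E_card: "E j = (1 / of_nat CARD(2 \<times> ('m \<times> 'n) + 2 \<times> ('m \<times> 'n))) \<cdot>\<^sub>m
      (\<Sum>i\<le>7. Q i j \<cdot>\<^sub>m scheme_mats W1 W2 i)" for j
    unfolding E_def card ..
  have "symmetric_association_scheme 7 (scheme_mats W1 W2)" "idempotent_ordering 7 (scheme_mats W1 W2) E"
    using scheme_of_idempotents[where A = "scheme_mats W1 W2" and d = 7,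
        OF zero_one_scheme_mats[OF W1 W2 disj blocks(1)[unfolded A_def]]
          scheme_mats_nonzero[OF m(2) n(2) nonzero compl] scheme_mats_0 sum_scheme_mats_eq_all_ones
          transpose_scheme_mats E_card A_E orth Q0 Q_ones] by blast+
  moreover have "is_first_eigenmatrix 7 (scheme_mats W1 W2) E P"
    unfolding is_first_eigenmatrix_def using A_E by blast
  moreover have "is_second_eigenmatrix 7 (scheme_mats W1 W2) E Q"
    unfolding is_second_eigenmatrix_def using E_card by blast
  ultimately show ?thesis unfolding P_def[abs_def] Q_def[abs_def] by blast
qed

end
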